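(* Let $b\ge2$ be an integer and let $\mathbf{s}=s_1s_2\ldots$ be a Sturmian or quasi-Sturmian word over $\{0,1,\ldots,b-1\}$. Then $$\mu\Big(\sum_{j\ge1}\frac{s_j}{b^j}\Big)\ge\frac53+\frac{4\sqrt{10}}{15}=2.5099\ldots,$$ with equality when $\mathbf{s}$ is the word $s_n=\lfloor (n+1)\theta+\rho\rfloor-\lfloor n\theta+\rho\rfloor$ ($n\ge1$) over $\{0,1\}$ with $\theta=\frac{\sqrt{10}-2}{3}$ and $\rho=\frac{\sqrt{10}-1}{3}$.
   Context: $p(n,\mathbf{s})$ is the number of distinct factors of length $n$ of $\mathbf{s}$. A Sturmian word satisfies $p(n,\mathbf{s})=n+1$ for all $n\ge1$; a quasi-Sturmian word satisfies $p(n,\mathbf{s})=n+k$ for all $n\ge n_0$, for some integers $k,n_0$. The irrationality exponent $\mu(\xi)$ is the supremum of the real $\mu$ such that $|\xi-p/q|<q^{-\mu}$ has infinitely many rational solutions $p/q$. *)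

theory Defs
  imports "HOL-Analysis.Analysis"
begin

text \<open>An infinite word s = s_1 s_2 ... is modelled as s :: nat => nat; the value s 0 is ignored.\<close>

definition factors :: "(nat \<Rightarrow> nat) \<Rightarrow> nat \<Rightarrow> nat list set" where
  "factors s n = {map (\<lambda>i. s (k + i)) [0..<n] | k. k \<ge> 1}"

definition complexity :: "(nat \<Rightarrow> nat) \<Rightarrow> nat \<Rightarrow> nat" where
  "complexity s n = card (factors s n)"

definition word_over :: "nat \<Rightarrow> (nat \<Rightarrow> nat) \<Rightarrow> bool" where
  "word_over b s \<longleftrightarrow> (\<forall>j\<ge>1. s j < b)"

definition sturmian :: "(nat \<Rightarrow> nat) \<Rightarrow> bool" where
  "sturmian s \<longleftrightarrow> (\<forall>n\<ge>1. complexity s n = n + 1)"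

definition quasi_sturmian :: "(nat \<Rightarrow> nat) \<Rightarrow> bool" where
  "quasi_sturmian s \<longleftrightarrow>
     (\<exists>(k::int) (n0::nat). \<forall>n\<ge>n0. int (complexity s n) = int n + k)"

definition word_value :: "nat \<Rightarrow> (nat \<Rightarrow> nat) \<Rightarrow> real" where
  "word_value b s = (\<Sum>j. real (s (Suc j)) / real b ^ Suc j)"

definition irrationality_exponent :: "real \<Rightarrow> ereal" where
  "irrationality_exponent \<xi> =
     Sup {ereal m | m. infinite {(p::int, q::int). q > 0 \<and> coprime p q \<and>
            \<bar>\<xi> - real_of_int p / real_of_int q\<bar> < real_of_int q powr (- m)}}"

end

theory Submission
  imports Defs
begin

text \<open>
  Let s be a (quasi-)Sturmian word. If a factor of length n occurs at positions i < j of s, then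
  the rational number with preperiod i and period j - i has denominator less than b^j and agrees
  with the value of s on j + n digits. So if the exponent were smaller than claimed, every such
  repetition would satisfy n \<le> lam * j + O(1) for some lam < 2/3 + 4 sqrt 10 / 15.
  Listing the repetitions with j minimal for given n, and using only that there are n + O(1)
  factors of length n with a unique right special one, these repetitions alternate between
  (0, q + q') and (S, S'), up to O(1), where q, q', q'', ... satisfy the continued fraction
  recurrence q'' = t * q' + q and S runs over the partial sums of the q's. The resulting linear
  inequalities q + q' \<le> lam * S and S' \<le> lam * (q + q') force t to be eventually
  2, 1, 1, 2, 1, 1, ..., and for this sequence S' / (q + q') tends to 2/3 + 4 sqrt 10 / 15
  along a subsequence.

  For the mechanical word with slope (sqrt 10 - 2) / 3 = [0; 2, 1, 1, 2, 1, 1, ...] all these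
  repetitions can be located exactly. They yield rational approximations so dense that they
  determine the irrationality exponent.
\<close>

section \<open>Repetitions in a word of complexity n + O(1)\<close>

text \<open>Over one block 2, 1, 1 a pair (a, b) of consecutive q's becomes (a + 3 b, 2 a + 5 b), a
  map with eigenvalues 3 + sqrt 10 and 3 - sqrt 10, while s - 2 b - 2/3 a is unchanged, s being the
  partial sum that ends in b. Hence b / a tends to \<kappa> = (2 + sqrt 10) / 3 and s / (a + b) to
  (2 \<kappa> + 2/3) / (1 + \<kappa>) = 2/3 + 4 sqrt 10 / 15 = 1.50994.... The obstacle is that
  everything about the word is known only up to bounded errors. Therefore the combinatorics and the
  exclusion of other quotients use the rational bound 151/100, slightly above the limit, and look
  only at repetitions so late that the errors are negligible; linear arithmetic then suffices. The
  true bound lam is exploited only at the end, where its distance from the limit has to beat errors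
  that accumulate linearly in the number of blocks. For the extremal word the error of each
  approximation is matched to the denominator of the next one, which leaves no room for unrelated
  good fractions.\<close>

definition agree :: "(nat \<Rightarrow> 'a) \<Rightarrow> nat \<Rightarrow> nat \<Rightarrow> nat \<Rightarrow> bool" where
  "agree s i j n \<longleftrightarrow> (\<forall>x<n. s (i + x) = s (j + x))"

lemma agree_sym: "agree s i j n \<Longrightarrow> agree s j i n"
  by (simp add: agree_def)

lemma agree_trans: "agree s i j n \<Longrightarrow> agree s j k n \<Longrightarrow> agree s i k n"
  by (simp add: agree_def)

lemma agree_mono: "agree s i j n \<Longrightarrow> m \<le> n \<Longrightarrow> agree s i j m"
  by (simp add: agree_def)

lemma agree_shift: "agree s i j (n + m) \<Longrightarrow> agree s (i + m) (j + m) n"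
  unfolding agree_def by (metis add.commute add.left_commute add_less_cancel_left)

lemma agree_Suc: "agree s i j (Suc n) \<longleftrightarrow> agree s i j n \<and> s (i + n) = s (j + n)"
  by (auto simp: agree_def less_Suc_eq)

lemma agreeD:
  assumes "agree s i j n" "i \<le> u" "u < i + n" "u + j = v + i"
  shows "s u = s v"
proof -
  have "u = i + (u - i)" "v = j + (u - i)" "u - i < n" using assms by auto
  then show ?thesis using assms(1) unfolding agree_def by metis
qed

lemma agree_period:
  assumes "agree s i (i + l) n" "i \<le> u" "u + k * l < i + l + n"
  shows "s (u + k * l) = s u"
  using assms(3)
proof (induction k)
  case (Suc k)
  then have "s (u + k * l) = s (u + Suc k * l)"
    using assms(2) by (intro agreeD[OF assms(1)]) auto
  then show ?case using Suc by simp
qed simp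

text \<open>This isolates what is used of a word of low complexity and too small exponent:
  \<open>pigeon\<close> counts factors, \<open>special\<close> is the uniqueness of the right
  special factor, and \<open>short\<close> says that no repetition yields too good an approximation.
  The value 151/100 lies just above 1.50994....\<close>

locale repetitive_word =
  fixes s :: "nat \<Rightarrow> 'a" and c n0 N0 :: nat and lam :: real
  assumes pigeon: "\<And>n. \<exists>i j. i < j \<and> j \<le> n + c \<and> agree s i j n"
    and special: "\<And>n i j i' j'. \<lbrakk>n0 \<le> n; agree s i j n; s (i + n) \<noteq> s (j + n);
        agree s i' j' n; s (i' + n) \<noteq> s (j' + n)\<rbrakk> \<Longrightarrow> agree s i i' n"
    and short: "\<And>i j n. \<lbrakk>i < j; agree s i j n\<rbrakk> \<Longrightarrow> real n \<le> lam * real j + real N0"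
    and lam_le: "lam \<le> 151/100"
begin

section \<open>Records among the repetitions\<close>

lemma short_nat:
  assumes "i < j" "agree s i j n"
  shows "100 * n \<le> 151 * j + 100 * N0"
proof -
  have "lam * real j \<le> 151/100 * real j" using lam_le by (intro mult_right_mono) auto
  then have "real (100 * n) \<le> real (151 * j + 100 * N0)" using short[OF assms] by simp
  then show ?thesis by (simp only: of_nat_le_iff)
qed

text \<open>The least position at which some factor of length n recurs is a step function of n. A
  triple is kept only at the right end of a step, which is the purpose of the last conjunct.\<close>

definition first_repeat :: "nat \<Rightarrow> nat \<Rightarrow> nat \<Rightarrow> bool" where
  "first_repeat i j n \<longleftrightarrow> i < j \<and> agree s i j n \<and> (\<forall>a b. a < b \<longrightarrow> agree s a b n \<longrightarrow> j \<le> b)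
     \<and> (\<forall>a b. a < b \<longrightarrow> agree s a b (Suc n) \<longrightarrow> j < b)"

lemma record_mismatch: "first_repeat i j n \<Longrightarrow> s (i + n) \<noteq> s (j + n)"
  unfolding first_repeat_def agree_Suc by blast

text \<open>Take the least recurrence position for length N and lengthen the repetition as far as
  this position permits; \<open>short\<close> bounds the length. Minimality already at length N is
  what later ties each record to its predecessor.\<close>

lemma record_exists:
  "\<exists>i j n. first_repeat i j n \<and> N \<le> n \<and> j \<le> N + c \<and> (\<forall>a b. a < b \<longrightarrow> agree s a b N \<longrightarrow> j \<le> b)"
proof -
  define P where "P j \<longleftrightarrow> (\<exists>i<j. agree s i j N)" for j
  obtain j0 where j0: "P j0" "j0 \<le> N + c" using pigeon[of N] unfolding P_def by blast
  define j where "j = (LEAST j. P j)"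
  have Pj: "P j" using j0(1) unfolding j_def by (rule LeastI)
  have jle: "j \<le> j0" using j0(1) unfolding j_def by (rule Least_le)
  have least: "j \<le> b" if "a < b" "agree s a b N" for a b
    unfolding j_def by (rule Least_le) (use that in \<open>auto simp: P_def\<close>)
  define Q where "Q n \<longleftrightarrow> (\<exists>i<j. agree s i j n)" for n
  have bnd: "\<forall>n. Q n \<longrightarrow> n \<le> 151 * j + 100 * N0"
  proof (intro allI impI)
    fix n assume "Q n"
    then obtain i where "i < j" "agree s i j n" unfolding Q_def by blast
    then show "n \<le> 151 * j + 100 * N0" using short_nat[of i j n] by linarith
  qed
  have QN: "Q N" using Pj unfolding P_def Q_def .
  define n where "n = (GREATEST n. Q n)"
  have Qn: "Q n" unfolding n_def using GreatestI_nat[where P = Q and k = N and b = "151 * j + 100 * N0"] QN bnd by blast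
  have gr: "k \<le> n" if "Q k" for k unfolding n_def using Greatest_le_nat[where P = Q and k = k and b = "151 * j + 100 * N0"] that bnd by blast
  have Nn: "N \<le> n" using gr[OF QN] .
  obtain i where i: "i < j" "agree s i j n" using Qn unfolding Q_def by blast
  have "first_repeat i j n" unfolding first_repeat_def
  proof (intro conjI allI impI)
    fix a b assume ab: "a < b" "agree s a b n"
    show "j \<le> b" using least[OF ab(1) agree_mono[OF ab(2) Nn]] .
  next
    fix a b assume ab: "a < b" "agree s a b (Suc n)"
    have "j \<le> b" using least[OF ab(1) agree_mono[OF ab(2)]] Nn by simp
    moreover have "b \<noteq> j" using gr[of "Suc n"] ab unfolding Q_def by auto
    ultimately show "j < b" by simp
  qed (use i in auto)
  then show ?thesis using Nn least jle j0(2) by (meson order_trans)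
qed

text \<open>If the period l = j - i did not divide v - u, the remainder g would also be a shift
  under which one full period is unchanged, hence the whole run. Then the factor of length n would
  recur at i + g < j, contrary to the minimality of j.\<close>

lemma record_occurrences:
  assumes "first_repeat i j n" "i \<le> u" "u < v" "v + m \<le> j + n" "agree s u v m" "j - i \<le> m"
  shows "(j - i) dvd (v - u)"
proof (rule ccontr)
  assume nd: "\<not> (j - i) dvd (v - u)"
  define l where "l = j - i"
  have j: "j = i + l" and l: "l > 0" using assms(1) by (auto simp: first_repeat_def l_def)
  have per: "agree s i (i + l) n" using assms(1) j by (simp add: first_repeat_def)
  define g where "g = (v - u) mod l"
  have g: "0 < g" "g < l" using nd l by (auto simp: g_def l_def mod_greater_zero_iff_not_dvd)
  define k where "k = (v - u) div l"
  have v: "v = u + g + k * l" using assms(3) div_mult_mod_eq[of "v - u" l] by (simp add: g_def k_def)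
  have period: "s (w + r * l) = s w" if "i \<le> w" "w + r * l < i + l + n" for w r
    using agree_period[OF per that] .
  have m: "l \<le> m" "v + m \<le> i + l + n" using assms(6) l_def assms(4) unfolding j by simp_all
  \<comment> \<open>The l letters from u on show the shift by g; all other letters of the run are
    reached from them by multiples of l.\<close>
  have base: "s y = s (y + g)" if y: "u \<le> y" "y < u + l" for y
  proof -
    have "s y = s (y + g + k * l)"
      by (rule agreeD[OF assms(5)]) (use y m(1) v in linarith)+
    also have "\<dots> = s (y + g)"
      by (rule period) (use y assms(2) v m in linarith)+
    finally show ?thesis .
  qed
  have all: "s y = s (y + g)" if y: "i \<le> y" "y < i + n" for y
  proof (cases "u \<le> y")
    case True
    define r where "r = (y - u) div l"
    define y0 where "y0 = u + (y - u) mod l"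
    have yy: "y = y0 + r * l" using True div_mult_mod_eq[of "y - u" l] by (simp add: y0_def r_def)
    have y0: "u \<le> y0" "y0 < u + l" using l by (auto simp: y0_def)
    have "s y = s y0" unfolding yy by (rule period) (use y yy y0 assms(2) in linarith)+
    also have "\<dots> = s (y0 + g)" using base y0 by simp
    also have "\<dots> = s (y0 + g + r * l)" by (rule period[symmetric]) (use y yy y0 assms(2) g in linarith)+
    also have "y0 + g + r * l = y + g" using yy by simp
    finally show ?thesis .
  next
    case False
    define r where "r = (u + l - 1 - y) div l"
    have "(u + l - 1 - y) mod l < l" using l by simp
    then have r: "u \<le> y + r * l" "y + r * l < u + l"
      using False l div_mult_mod_eq[of "u + l - 1 - y" l] unfolding r_def by linarith+
    have bd: "u + l + g \<le> i + l + n" using m v by linarith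
    have "s y = s (y + r * l)" by (rule period[symmetric]) (use y r bd in linarith)+
    also have "\<dots> = s (y + r * l + g)" using base r by simp
    also have "y + r * l + g = y + g + r * l" by simp
    also have "s \<dots> = s (y + g)" by (rule period) (use y r bd in linarith)+
    finally show ?thesis .
  qed
  have "s (i + x) = s (i + g + x)" if "x < n" for x
    using all[of "i + x"] that by (metis add.assoc add.commute add_less_cancel_left le_add1)
  then have "agree s i (i + g) n" by (simp add: agree_def)
  moreover have "j \<le> b" if "a < b" "agree s a b n" for a b
    using assms(1) that by (simp add: first_repeat_def)
  ultimately have "j \<le> i + g" using g(1) by (metis less_add_same_cancel1)
  then show False using g(2) unfolding j by simp
qed

end

text \<open>J k is the first position at which a factor of length N k occurs for the second time, and I k
  the position of its first occurrence. Indices with I k \<le> c and with I k > c turn out to alternate;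
  up to bounded errors the former are the repetitions (0, q + q'), the latter (S, S').\<close>

locale record_sequence = repetitive_word s c n0 N0 lam
  for s :: "nat \<Rightarrow> 'a" and c n0 N0 lam +
  fixes I J N :: "nat \<Rightarrow> nat"
  assumes rec: "\<And>k. first_repeat (I k) (J k) (N k)"
    and N_less: "\<And>k. N k < N (Suc k)"
    and J_le: "\<And>k. J (Suc k) \<le> Suc (N k) + c"
    and first: "\<And>k a b. a < b \<Longrightarrow> agree s a b (Suc (N k)) \<Longrightarrow> J (Suc k) \<le> b"
    and J_big: "\<And>k. J k \<ge> 1000 * c + 1000 * n0 + 1000 * N0 + 1000"
begin

section \<open>Alternation of runs near the origin and runs far from it\<close>

lemma IJ: "I k < J k" using rec[of k] by (simp add: first_repeat_def)
lemma ag: "agree s (I k) (J k) (N k)" using rec[of k] by (simp add: first_repeat_def)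
lemma mismatch: "s (I k + N k) \<noteq> s (J k + N k)" using record_mismatch[OF rec] .
lemma J_first: "a < b \<Longrightarrow> agree s a b (N k) \<Longrightarrow> J k \<le> b" using rec[of k] by (simp add: first_repeat_def)

lemma J_less: "J k < J (Suc k)"
proof -
  have "agree s (I (Suc k)) (J (Suc k)) (Suc (N k))"
    using ag[of "Suc k"] N_less[of k] by (auto intro: agree_mono)
  then show ?thesis using rec[of k] IJ[of "Suc k"] by (simp add: first_repeat_def)
qed

lemma N_short: "100 * N k \<le> 151 * J k + 100 * N0"
  using short_nat[OF IJ ag] .

lemma N_ge: "N k \<ge> n0"
  using J_le[of k] J_big[of "Suc k"] by simp

text \<open>Before the run of period p ends, it overlaps the next run, of period p', in fewer than p + p'
  letters: otherwise stepping back from the mismatch by p and by p' in either order gives equal letters.\<close>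

lemma J_greater: "N k + min (I k) (I (Suc k)) < J (Suc k)"
proof (rule ccontr)
  assume a: "\<not> N k + min (I k) (I (Suc k)) < J (Suc k)"
  define u where "u = I k + N k + I (Suc k) - J (Suc k)"
  have u: "u + J (Suc k) = I k + N k + I (Suc k)" using a by (simp add: u_def)
  note le = IJ[of k] IJ[of "Suc k"] J_less[of k] N_less[of k]
  have "s u = s (I k + N k)"
    using u a le by (intro agreeD[OF ag[of "Suc k"]]) auto
  moreover have "s u = s (u + J k - I k)"
    using u a le by (intro agreeD[OF ag[of k]]) auto
  moreover have "s (u + J k - I k) = s (J k + N k)"
    using u a le by (intro agreeD[OF ag[of "Suc k"]]) auto
  ultimately show False using mismatch[of k] by simp
qed

lemma min_le: "min (I k) (I (Suc k)) \<le> c"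
  using J_greater[of k] J_le[of k] by simp

lemma alternate1: "I k > c \<Longrightarrow> I (Suc k) \<le> c"
  using min_le[of k] by auto

text \<open>If both runs began within c, the part of the first run beyond J (Suc k) could be moved
  back by either period. This gives a repetition of length about J k with second position at most
  about 0.51 * J k, too long for \<open>short\<close>; equal landing points would contradict the
  mismatch.\<close>

lemma alternate2:
  assumes "I k \<le> c"
  shows "I (Suc k) > c"
proof (rule ccontr)
  assume "\<not> I (Suc k) > c"
  then have i': "I (Suc k) \<le> c" by simp
  note le = IJ[of k] IJ[of "Suc k"] J_less[of k] N_less[of k] J_greater[of k] J_le[of k] N_short[of k] J_big[of k]
  define p where "p = J (Suc k) + I k - J k"
  have p: "p + J k = J (Suc k) + I k" using le by (simp add: p_def)
  define M where "M = J k + N k - J (Suc k)"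
  have M: "M + J (Suc k) = J k + N k" using le by (simp add: M_def)
  have agr: "agree s (I (Suc k)) p M" unfolding agree_def
  proof (intro allI impI)
    fix x assume x: "x < M"
    have "s (p + x) = s (J (Suc k) + x)"
      using x p M le by (intro agreeD[OF ag[of k]]) auto
    moreover have "s (I (Suc k) + x) = s (J (Suc k) + x)"
      using x M le by (intro agreeD[OF ag[of "Suc k"]]) auto
    ultimately show "s (I (Suc k) + x) = s (p + x)" by simp
  qed
  consider "p = I (Suc k)" | "I (Suc k) < p" | "p < I (Suc k)" by linarith
  then show False
  proof cases
    case 1
    have "s (I k + N k) = s (J k + N k)"
      using 1 p le i' by (intro agreeD[OF ag[of "Suc k"]]) auto
    then show False using mismatch by blast
  next
    case 2
    then show False using short_nat[OF 2 agr] M p le assms i' by auto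
  next
    case 3
    then show False using short_nat[OF 3 agree_sym[OF agr]] M p le assms i' by auto
  qed
qed

text \<open>The two copies in record Suc k are followed by different letters, so their suffix of
  length N k is right special. So is the factor of record k, and there is only one such
  factor.\<close>

lemma special_suffix:
  "agree s (I k) (I (Suc k) + (N (Suc k) - N k)) (N k)"
  "agree s (I k) (J (Suc k) + (N (Suc k) - N k)) (N k)"
proof -
  define r where "r = N (Suc k) - N k"
  have r: "N (Suc k) = N k + r" using N_less[of k] by (simp add: r_def)
  have a: "agree s (I (Suc k) + r) (J (Suc k) + r) (N k)"
    using ag[of "Suc k"] unfolding r by (rule agree_shift)
  have "s (I (Suc k) + r + N k) \<noteq> s (J (Suc k) + r + N k)"
    using mismatch[of "Suc k"] unfolding r by (simp add: ac_simps)
  then have "agree s (I k) (I (Suc k) + r) (N k)"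
    using special[OF N_ge ag mismatch a] by blast
  then show "agree s (I k) (I (Suc k) + (N (Suc k) - N k)) (N k)"
    "agree s (I k) (J (Suc k) + (N (Suc k) - N k)) (N k)"
    using a agree_trans unfolding r_def by blast+
qed

text \<open>The right special suffix gives a copy of the factor of record k at I (Suc k) + N (Suc k)
  - N k. This position and I k are both below J k, before which no factor of length N k recurs, so
  they coincide.\<close>

lemma small_length:
  assumes "I k > c"
  shows "I (Suc k) + N (Suc k) = I k + N k"
proof -
  note le = N_less[of k] J_le[of k] N_short[of k] N_short[of "Suc k"] J_big[of k] IJ[of k] alternate1[OF assms]
  define p where "p = I (Suc k) + (N (Suc k) - N k)"
  have a: "agree s (I k) p (N k)" using special_suffix(1) unfolding p_def .
  consider "p = I k" | "p < I k" | "I k < p" by linarith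
  then show ?thesis
  proof cases
    case 1
    then show ?thesis using le(1) by (simp add: p_def)
  next
    case 2
    then show ?thesis using J_first[OF 2 agree_sym[OF a]] le by simp
  next
    case 3
    then show ?thesis using J_first[OF 3 a] le unfolding p_def by linarith
  qed
qed

lemma big_I_bound:
  assumes "I k > c"
  shows "100 * I k \<le> 51 * N k + 300 * c + 300 * N0 + 300"
  using small_length[OF assms] J_le[of k] N_short[of "Suc k"] alternate1[OF assms] by linarith

text \<open>The period of a run far from the origin is thus at least a fifth of J k. The value 4/5
  leaves room above 0.51 * 1.51 = 0.7701 for the additive constants.\<close>

lemma big_period_bound:
  assumes "I k > c"
  shows "5 * I k \<le> 4 * J k"
  using big_I_bound[OF assms] N_short[of k] J_big[of k] by linarith

text \<open>Otherwise the right special factor would occur shortly after I (Suc k) and again at J k,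
  both inside the next run and closer together than its period, contrary to
  \<open>record_occurrences\<close>.\<close>

lemma gap:
  assumes "I k \<le> c"
  shows "N (Suc k) > N k + 5 * c"
proof (rule ccontr)
  assume n: "\<not> N (Suc k) > N k + 5 * c"
  have i': "I (Suc k) > c" using alternate2[OF assms] .
  define u where "u = I (Suc k) + (N (Suc k) - N k)"
  note le = N_less[of k] J_le[of k] N_short[of k] J_big[of k] J_less[of k] big_I_bound[OF i'] IJ[of "Suc k"] J_greater[of k]
  have uv: "u < J k" using n le by (simp add: u_def)
  have "agree s u (J k) (N k)"
    using special_suffix(1)[of k] ag[of k] agree_sym agree_trans unfolding u_def by blast
  then have "(J (Suc k) - I (Suc k)) dvd (J k - u)"
    using uv le i' by (intro record_occurrences[OF rec, of "Suc k" u "J k" "N k"]) (auto simp: u_def)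
  then have "J (Suc k) - I (Suc k) \<le> J k - u" using uv by (simp add: dvd_imp_le)
  then show False using le uv unfolding u_def by linarith
qed

text \<open>Moving the factor of record k + 1 forward by the period of run k + 2 and back by that of
  run k + 3 gives a further occurrence, up to c letters at each end, near I (k + 3). Minimality of J
  (k + 1) bounds its position from below, the mismatch ending run k + 1 from above. As a
  consequence, the second positions of the far runs are partial sums of their periods.\<close>

lemma next_big:
  assumes "I k \<le> c"
  shows "I (k + 3) \<le> J (k + 1) + 2 * c" "J (k + 1) \<le> I (k + 3) + 2 * c"
proof -
  define i d n where "i = I (k + 1)" "d = J (k + 1)" "n = N (k + 1)"
  define e D m where "e = I (k + 2)" "D = J (k + 2)" "m = N (k + 2)"
  define i' d' n' where "i' = I (k + 3)" "d' = J (k + 3)" "n' = N (k + 3)"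
  note defs = i_d_n_def e_D_m_def i'_d'_n'_def
  have ex: "k + 1 = Suc k" "k + 2 = Suc (Suc k)" "k + 3 = Suc (Suc (Suc k))" by auto
  have i: "i > c" using alternate2[OF assms] by (simp add: defs)
  have e: "e \<le> c" using alternate1 i by (simp add: defs ex)
  have i': "i' > c" using alternate2 e by (simp add: defs ex)
  have gap': "n > N k + 5 * c" using gap[OF assms] by (simp add: defs)
  have m: "e + m = i + n" using small_length[of "k+1"] i by (simp add: defs)
  have bi: "5 * i \<le> 4 * d" using big_period_bound[of "k+1"] i by (simp add: defs)
  have bi': "5 * i' \<le> 4 * d'" using big_period_bound[of "k+3"] i' by (simp add: defs)
  have D: "n < D" "D \<le> n + 1 + c" using J_greater[of "k+1"] J_le[of "k+1"] by (auto simp: defs)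
  have d': "m < d'" "d' \<le> m + 1 + c" using J_greater[of "k+2"] J_le[of "k+2"] by (auto simp: defs ex)
  have lt: "i < d" "d < D" "D < d'" "n < m" "m < n'" "i' < d'"
    using IJ[of "k+1"] J_less[of "k+1"] J_less[of "k+2"] N_less[of "k+1"] N_less[of "k+2"] IJ[of "k+3"]
    by (auto simp: defs ex)
  have db: "d \<ge> 1000 * c + 1000 * n0 + 1000 * N0 + 1000" using J_big by (simp add: defs)
  have agd: "agree s i d n" "agree s e D m" "agree s i' d' n'"
    using ag[of "k+1"] ag[of "k+2"] ag[of "k+3"] by (auto simp: defs)
  \<comment> \<open>This is i + (D - e) - (d' - i'), the position i after the two shifts.\<close>
  define q where "q = i + D + i' - (e + d')"
  have "e + d' \<le> i + D + i'" using m D d' i' by linarith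
  then have q: "q + e + d' = i + D + i'" by (simp add: q_def)
  have qi: "q \<le> i' + c" "i' \<le> q + c" using q m D d' by linarith+
  have agq: "agree s (i + c) (q + c) (n - 2 * c)" unfolding agree_def
  proof (intro allI impI)
    fix x assume x: "x < n - 2 * c"
    define v where "v = i + c + x + D - e"
    have v: "v + e = i + c + x + D" using lt e i by (simp add: v_def)
    have "s (i + c + x) = s v" using x i e m v by (intro agreeD[OF agd(2)]) auto
    moreover have "s (q + c + x) = s v" using x qi lt q v by (intro agreeD[OF agd(3)]) auto
    ultimately show "s (i + c + x) = s (q + c + x)" by simp
  qed
  have agq': "agree s (i + c) (q + c) (Suc (N k))"
    using agq gap' by (auto intro: agree_mono)
  \<comment> \<open>If q = i, runs k + 2 and k + 3 would have the same period, and the later run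
    would cover the mismatch of the earlier one.\<close>
  have qni: "q \<noteq> i"
  proof
    assume "q = i"
    then have "s (e + m) = s (D + m)"
      using q qi m lt d' gap' by (intro agreeD[OF agd(3)]) auto
    then show False using mismatch[of "k+2"] by (simp add: defs)
  qed
  have dq: "d \<le> q + c"
  proof (cases "i < q")
    case True
    then show ?thesis using first[OF _ agq'] by (simp add: defs)
  next
    case False
    then have "d \<le> i + c" using first[OF _ agree_sym[OF agq']] qni by (simp add: defs)
    then show ?thesis using bi db by linarith
  qed
  then show "J (k + 1) \<le> I (k + 3) + 2 * c" using qi by (simp add: defs)
  \<comment> \<open>Otherwise p = q - d would be another period of the second copy. Stepping back
    from the mismatch by p and by d - i in either order is impossible, so i + n < q + c; but then
    run k + 3 would have a bounded period.\<close>
  have "q \<le> d + c"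
  proof (rule ccontr)
    assume "\<not> q \<le> d + c"
    then have a: "d + c < q" by simp
    define p where "p = q - d"
    have p: "q = d + p" "p > c" using a by (simp_all add: p_def)
    have agp: "s y = s (y + p)" if y: "d + c \<le> y" "y + c < d + n" for y
    proof -
      have "s (y - d + i) = s y" using y by (intro agreeD[OF agd(1)]) auto
      moreover have "s (y - d + i) = s (y + p)" using y p by (intro agreeD[OF agq]) auto
      ultimately show ?thesis by simp
    qed
    have "n < p + (d - i) + c"
    proof (rule ccontr)
      assume "\<not> n < p + (d - i) + c"
      then have a: "p + (d - i) + c \<le> n" by simp
      have "s (d + n - p) = s (d + n)" using agp[of "d + n - p"] a p lt by simp
      moreover have "s (i + n - p) = s (d + n - p)" using a p lt by (intro agreeD[OF agd(1)]) auto
      moreover have "s (i + n - p) = s (i + n)" using agp[of "i + n - p"] a p lt by simp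
      ultimately show False using mismatch[of "k+1"] by (simp add: defs)
    qed
    then have "i + n < q + c" using p lt by linarith
    then have "d' \<le> i' + 3 * c + 1" using qi m d' by linarith
    then show False using bi' db lt by linarith
  qed
  then show "I (k + 3) \<le> J (k + 1) + 2 * c" using qi by (simp add: defs)
qed

text \<open>J k and the end part of the second copy in record Suc k are two occurrences of the right
  special factor inside the run of record Suc k, so the period divides their distance. The quotient
  t will be the partial quotient.\<close>

lemma big_recurrence:
  assumes "I k \<le> c" "I (Suc k) \<le> J k"
  shows "\<exists>t\<ge>1. J (Suc k) + N (Suc k) = J k + N k + t * (J (Suc k) - I (Suc k))"
proof -
  have i': "I (Suc k) > c" using alternate2[OF assms(1)] .
  note le = N_less[of k] J_le[of k] J_less[of k] IJ[of "Suc k"] i'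
  define v where "v = J (Suc k) + (N (Suc k) - N k)"
  have "agree s (J k) v (N k)"
    using special_suffix(2)[of k] ag[of k] agree_sym agree_trans unfolding v_def by blast
  then have "(J (Suc k) - I (Suc k)) dvd (v - J k)"
    using assms le by (intro record_occurrences[OF rec, of "Suc k" "J k" v "N k"]) (auto simp: v_def)
  then obtain t where t: "v - J k = (J (Suc k) - I (Suc k)) * t" by (rule dvdE)
  have "t \<ge> 1" using t le by (cases t) (auto simp: v_def)
  moreover have "J (Suc k) + N (Suc k) = J k + N k + t * (J (Suc k) - I (Suc k))"
    using t le unfolding v_def by (simp add: mult.commute)
  ultimately show ?thesis by blast
qed

end

section \<open>The induced linear recurrence\<close>

lemma sqrt10_bounds: "(31622/10000::real) < sqrt 10" "sqrt 10 < (31623/10000::real)"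
proof -
  show "(31622/10000::real) < sqrt 10" by (rule real_less_rsqrt) (simp add: power2_eq_square)
  show "sqrt 10 < (31623/10000::real)" by (rule real_less_lsqrt) (simp_all add: power2_eq_square)
qed

lemma bounded_of_contraction:
  fixes y :: "nat \<Rightarrow> real"
  assumes "c \<le> 1/2" "0 \<le> E" and step: "\<And>m. \<bar>y (Suc m)\<bar> \<le> c * \<bar>y m\<bar> + E"
  shows "\<bar>y m\<bar> \<le> \<bar>y 0\<bar> + 2 * E"
proof (induction m)
  case 0
  show ?case using assms(2) by simp
next
  case (Suc m)
  have "\<bar>y (Suc m)\<bar> \<le> \<bar>y m\<bar> / 2 + E"
    using step[of m] mult_right_mono[OF assms(1), of "\<bar>y m\<bar>"] by simp
  then show ?case using Suc by linarith
qed

text \<open>Since q dominates C, a quotient above 2 and the patterns 2, 2 and 1, 1, 1 and 1, 2, 1, 2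
  are refuted by linear arithmetic from a few instances of A and B. The only sequence avoiding them
  is eventually 2, 1, 1 repeated.\<close>

lemma recurrence_quotients:
  fixes q S :: "nat \<Rightarrow> real" and t :: "nat \<Rightarrow> nat"
  assumes big: "\<And>k. q k \<ge> 10000 * C" "C > 0"
    and inc: "\<And>k. q k \<le> q (Suc k)"
    and S: "\<And>k. \<bar>S (Suc k) - S k - q (Suc k)\<bar> \<le> C"
    and t: "\<And>k. t k \<ge> 1" "\<And>k. \<bar>q (Suc (Suc k)) - real (t k) * q (Suc k) - q k\<bar> \<le> C"
    and A: "\<And>k. q (Suc k) + q k \<le> 151/100 * S k + C"
    and B: "\<And>k. S (Suc k) \<le> 151/100 * (q k + q (Suc k)) + C"
  shows "\<exists>k0. \<forall>m. t (k0 + 3 * m) = 2 \<and> t (k0 + 3 * m + 1) = 1 \<and> t (k0 + 3 * m + 2) = 1"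
proof -
  have S': "S (Suc k) \<le> S k + q (Suc k) + C" "S k + q (Suc k) - C \<le> S (Suc k)" for k
    using S[of k] by (simp_all add: abs_le_iff)
  have le2: "t k \<le> 2" for k
  proof (rule ccontr)
    assume "\<not> t k \<le> 2"
    then have "real (t k) * q (Suc k) \<ge> 3 * q (Suc k)"
      using big(1)[of "Suc k"] big(2) by (intro mult_right_mono) auto
    then have "q (Suc (Suc k)) \<ge> 3 * q (Suc k) + q k - C"
      using t(2)[of k] by (simp add: abs_le_iff)
    then show False
      using S'[of k] A[of k] A[of "Suc k"] B[of k] B[of "Suc k"]
        big(1)[of k] inc[of k] big(2) by (simp add: field_simps)
  qed
  have t12: "t k = 1 \<or> t k = 2" for k using le2[of k] t(1)[of k] by linarith
  have r1: "q (Suc (Suc k)) \<le> q (Suc k) + q k + C" "q (Suc k) + q k - C \<le> q (Suc (Suc k))" if "t k = 1" for k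
    using t(2)[of k] that by (simp_all add: abs_le_iff)
  have r2: "q (Suc (Suc k)) \<le> 2 * q (Suc k) + q k + C" "2 * q (Suc k) + q k - C \<le> q (Suc (Suc k))" if "t k = 2" for k
    using t(2)[of k] that by (simp_all add: abs_le_iff)
  have n22: False if "t k = 2" "t (Suc k) = 2" for k
    using r2[OF that(1)] r2[OF that(2)] S'[of k] S'[of "Suc k"]
      A[of "Suc (Suc k)"] B[of k]
      big(1)[of k] inc[of k] big(2)
    by (simp add: field_simps)
  have n111: False if "t k = 1" "t (Suc k) = 1" "t (Suc (Suc k)) = 1" for k
    using r1[OF that(1)] r1[OF that(2)] r1[OF that(3)]
      S'[of k] S'[of "Suc k"] S'[of "Suc (Suc k)"] S'[of "Suc (Suc (Suc k))"]
      A[of k] B[of "Suc (Suc (Suc k))"]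
      big(1)[of k] inc[of k] big(2)
    by (simp add: field_simps)
  have n1212: False if "t k = 1" "t (Suc k) = 2" "t (Suc (Suc k)) = 1" "t (Suc (Suc (Suc k))) = 2" for k
    using r1[OF that(1)] r2[OF that(2)] r1[OF that(3)] r2[OF that(4)]
      S'[of k] S'[of "Suc k"] S'[of "Suc (Suc k)"] S'[of "Suc (Suc (Suc k))"]
      A[of "Suc (Suc (Suc (Suc k)))"] B[of k]
      big(1)[of k] inc[of k] big(2)
    by (simp add: field_simps)
  \<comment> \<open>The search starts at index 1 so that every 2 considered has a predecessor, which
    the exclusion of 1, 2, 1, 2 needs.\<close>
  obtain k0 where k0: "t k0 = 2" "k0 \<ge> 1"
    using n111[of 1] t12[of 1] t12[of 2] t12[of 3] by (auto simp: numeral_2_eq_2 numeral_3_eq_3)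
  have step: "t (k+1) = 1 \<and> t (k+2) = 1 \<and> t (k+3) = 2" if k: "t k = 2" "k \<ge> 1" for k
  proof -
    obtain j where j: "k = Suc j" using k(2) by (cases k) auto
    have a: "t (k+1) = 1" using n22[of k] t12[of "k+1"] k(1) by auto
    have b: "t j = 1" using n22[of j] t12[of j] k(1) j by auto
    have c: "t (k+2) = 1" using n1212[of j] t12[of "k+2"] k(1) a b j by (auto simp: eval_nat_numeral)
    show ?thesis using a c n111[of "k+1"] t12[of "k+3"] by (auto simp: eval_nat_numeral)
  qed
  have "t (k0 + 3 * m) = 2" for m
  proof (induction m)
    case (Suc m)
    then show ?case using step[of "k0 + 3 * m"] k0(2) by (simp add: algebra_simps)
  qed (use k0 in simp)
  then show ?thesis using step k0(2) by (meson le_add1 le_trans)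
qed


lemma recurrence_contradiction:
  fixes q S :: "nat \<Rightarrow> real"
  assumes lam: "0 < lam" "lam < 2/3 + 4 * sqrt 10 / 15"
    and grow: "\<And>M. \<exists>K. \<forall>k\<ge>K. q k \<ge> M"
    and S: "\<And>k. \<bar>S (Suc k) - S k - q (Suc k)\<bar> \<le> C"
    and rec: "\<And>k. \<exists>t::nat. t \<ge> 1 \<and> \<bar>q (Suc (Suc k)) - real t * q (Suc k) - q k\<bar> \<le> C"
    and A: "\<And>k. q (Suc k) + q k \<le> lam * S k + C"
    and B: "\<And>k. S (Suc k) \<le> lam * (q k + q (Suc k)) + C"
  shows False
proof -
  \<comment> \<open>The form b - \<kappa> * a is an eigenvector of the block map for 3 - sqrt 10, so
    it stays bounded. Substituting b by \<kappa> * a in 2 * b + 2/3 * a - lam * (a + b) leaves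
    \<open>gap * a\<close>.\<close>
  define \<kappa> where "\<kappa> = (2 + sqrt 10) / 3"
  define gap where "gap = (2/3 + 4 * sqrt 10 / 15 - lam) * (1 + \<kappa>)"
  have \<kappa>: "0 < \<kappa>" "\<kappa> < 2" using sqrt10_bounds by (simp_all add: \<kappa>_def)
  have gap: "gap > 0" using lam \<kappa> by (simp add: gap_def)
  have lam_le: "lam \<le> 151/100" using lam sqrt10_bounds by simp
  have C0: "C \<ge> 0" using S[of 0] abs_ge_zero order_trans by blast
  define C1 where "C1 = C + 1"
  \<comment> \<open>With all q at least M, the term \<open>gap * a\<close> gains more than 20 * C1
    per block, which is all that the accumulated errors can absorb.\<close>
  define M where "M = 10000 * C1 + (100 * C1 + 1) / gap"
  have M: "M \<ge> 10000 * C1" "gap * (M - C1) \<ge> 100 * C1 + 1 - gap * C1 + gap * 10000 * C1"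
    using gap C0 by (simp_all add: M_def C1_def field_simps)
  obtain K where K: "\<And>k. k \<ge> K \<Longrightarrow> q k \<ge> M" using grow by blast
  \<comment> \<open>The shift is Suc K and not K because monotonicity at the first index uses the
    recurrence with the preceding term, which must be large as well.\<close>
  define q' where "q' k = q (k + Suc K)" for k
  define S' where "S' k = S (k + Suc K)" for k
  have big: "q' k \<ge> M" for k using K by (simp add: q'_def)
  have big': "q' k \<ge> 10000 * C1" for k using big[of k] M(1) by linarith
  have "\<exists>t::nat. t \<ge> 1 \<and> \<bar>q' (Suc (Suc k)) - real t * q' (Suc k) - q' k\<bar> \<le> C1" for k
    using rec[of "k + Suc K"] by (fastforce simp: q'_def C1_def)
  then obtain t :: "nat \<Rightarrow> nat" where t: "\<And>k. t k \<ge> 1"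
      "\<And>k. \<bar>q' (Suc (Suc k)) - real (t k) * q' (Suc k) - q' k\<bar> \<le> C1" by metis
  have inc: "q' k \<le> q' (Suc k)" for k
  proof -
    obtain u :: nat where u: "u \<ge> 1" "\<bar>q (Suc (Suc (k + K))) - real u * q (Suc (k + K)) - q (k + K)\<bar> \<le> C"
      using rec by blast
    have "real u * q (Suc (k + K)) \<ge> 1 * q (Suc (k + K))"
      using u(1) K[of "Suc (k + K)"] M(1) C0 by (intro mult_right_mono) (auto simp: C1_def)
    moreover have "q (k + K) \<ge> C" using K[of "k + K"] M(1) C0 by (simp add: C1_def)
    ultimately show ?thesis using u(2) by (simp add: q'_def abs_le_iff)
  qed
  have SS: "\<bar>S' (Suc k) - S' k - q' (Suc k)\<bar> \<le> C1" for k
    using S[of "k + Suc K"] by (simp add: S'_def q'_def C1_def)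
  have AA: "q' (Suc k) + q' k \<le> lam * S' k + C1" for k
    using A[of "k + Suc K"] by (simp add: S'_def q'_def C1_def)
  have BB: "S' (Suc k) \<le> lam * (q' k + q' (Suc k)) + C1" for k
    using B[of "k + Suc K"] by (simp add: S'_def q'_def C1_def)
  have Spos: "S' k \<ge> 0" for k
  proof (rule ccontr)
    assume "\<not> S' k \<ge> 0"
    then have "lam * S' k \<le> 0" using lam by (simp add: mult_le_0_iff)
    then show False using AA[of k] big'[of k] big'[of "Suc k"] C0 by (simp add: C1_def)
  qed
  have "\<exists>k0. \<forall>m. t (k0 + 3 * m) = 2 \<and> t (k0 + 3 * m + 1) = 1 \<and> t (k0 + 3 * m + 2) = 1"
  proof (rule recurrence_quotients[where q = q' and S = S' and C = C1])
    show "0 < C1" using C0 by (simp add: C1_def)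
    show "q' (Suc k) + q' k \<le> 151/100 * S' k + C1" for k
      using AA[of k] mult_right_mono[OF lam_le Spos[of k]] by linarith
    show "S' (Suc k) \<le> 151/100 * (q' k + q' (Suc k)) + C1" for k
    proof -
      have "0 \<le> q' k + q' (Suc k)" using big'[of k] big'[of "Suc k"] C0 by (simp add: C1_def)
      then have "lam * (q' k + q' (Suc k)) \<le> 151/100 * (q' k + q' (Suc k))"
        by (rule mult_right_mono[OF lam_le])
      then show ?thesis using BB[of k] by linarith
    qed
  qed (use big' inc SS t in auto)
  then obtain k0 where k0: "\<And>m. t (k0 + 3 * m) = 2" "\<And>m. t (k0 + 3 * m + 1) = 1" "\<And>m. t (k0 + 3 * m + 2) = 1"
    by blast
  define a where "a m = q' (k0 + 3 * m)" for m
  define b where "b m = q' (Suc (k0 + 3 * m))" for m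
  define s where "s m = S' (Suc (k0 + 3 * m))" for m
  have r: "\<bar>a (Suc m) - a m - 3 * b m\<bar> \<le> 2 * C1" "\<bar>b (Suc m) - 2 * a m - 5 * b m\<bar> \<le> 4 * C1"
    "\<bar>s (Suc m) - s m - 4 * a m - 10 * b m\<bar> \<le> 10 * C1" for m
  proof -
    let ?k = "k0 + 3 * m"
    have e: "k0 + 3 * Suc m = Suc (Suc (Suc ?k))" by simp
    have 1: "\<bar>q' (Suc (Suc ?k)) - 2 * b m - a m\<bar> \<le> C1" using t(2)[of ?k] k0(1)[of m] by (simp add: a_def b_def)
    have 2: "\<bar>a (Suc m) - q' (Suc (Suc ?k)) - b m\<bar> \<le> C1"
      using t(2)[of "Suc ?k"] k0(2)[of m] unfolding a_def b_def e by simp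
    have 3: "\<bar>b (Suc m) - a (Suc m) - q' (Suc (Suc ?k))\<bar> \<le> C1"
      using t(2)[of "Suc (Suc ?k)"] k0(3)[of m] unfolding a_def b_def e by simp
    have 4: "\<bar>S' (Suc (Suc ?k)) - s m - q' (Suc (Suc ?k))\<bar> \<le> C1"
      using SS[of "Suc ?k"] unfolding s_def e by simp
    have 5: "\<bar>S' (Suc (Suc (Suc ?k))) - S' (Suc (Suc ?k)) - a (Suc m)\<bar> \<le> C1"
      using SS[of "Suc (Suc ?k)"] unfolding a_def e by simp
    have 6: "\<bar>s (Suc m) - S' (Suc (Suc (Suc ?k))) - b (Suc m)\<bar> \<le> C1"
      using SS[of "Suc (Suc (Suc ?k))"] unfolding s_def b_def e by simp
    show "\<bar>a (Suc m) - a m - 3 * b m\<bar> \<le> 2 * C1" using 1 2 by linarith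
    show "\<bar>b (Suc m) - 2 * a m - 5 * b m\<bar> \<le> 4 * C1" using 1 2 3 by linarith
    show "\<bar>s (Suc m) - s m - 4 * a m - 10 * b m\<bar> \<le> 10 * C1" using 1 2 3 4 5 6 by linarith
  qed
  define y where "y m = b m - \<kappa> * a m" for m
  have y_step: "\<bar>y (Suc m)\<bar> \<le> (sqrt 10 - 3) * \<bar>y m\<bar> + 8 * C1" for m
  proof -
    have eq: "y (Suc m) - (3 - sqrt 10) * y m
        = (b (Suc m) - 2 * a m - 5 * b m) - \<kappa> * (a (Suc m) - a m - 3 * b m)"
      by (simp add: y_def \<kappa>_def field_simps)
    have "\<bar>\<kappa> * (a (Suc m) - a m - 3 * b m)\<bar> \<le> 2 * (2 * C1)"
      unfolding abs_mult using r(1)[of m] \<kappa> by (intro mult_mono) auto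
    then have "\<bar>y (Suc m) - (3 - sqrt 10) * y m\<bar> \<le> 8 * C1"
      unfolding eq using r(2)[of m] by linarith
    moreover have "\<bar>(3 - sqrt 10) * y m\<bar> = (sqrt 10 - 3) * \<bar>y m\<bar>"
      using sqrt10_bounds by (simp add: abs_mult)
    ultimately show ?thesis by linarith
  qed
  define Y where "Y = \<bar>y 0\<bar> + 16 * C1"
  have yb: "\<bar>y m\<bar> \<le> Y" for m
    using bounded_of_contraction[where y = y and c = "sqrt 10 - 3" and E = "8 * C1", OF _ _ y_step, of m] sqrt10_bounds C0 by (simp add: Y_def C1_def)
  \<comment> \<open>The left side is invariant under an error-free block; the errors 10, 2 * 4 and
    2/3 * 2, in units of C1, add up to less than 20.\<close>
  have z: "s m - 2 * b m - 2/3 * a m \<ge> s 0 - 2 * b 0 - 2/3 * a 0 - 20 * C1 * m" for m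
  proof (induction m)
    case (Suc m)
    have "s (Suc m) - 2 * b (Suc m) - 2/3 * a (Suc m) \<ge> s m - 2 * b m - 2/3 * a m - 20 * C1"
      using r[of m] C0 by (simp add: abs_le_iff C1_def)
    then show ?case using Suc by (simp add: algebra_simps)
  qed simp
  have a_lin: "a m \<ge> real m * (M - C1)" for m
  proof (induction m)
    case 0
    show ?case using big'[of k0] C0 by (simp add: a_def C1_def)
  next
    case (Suc m)
    have "b m \<ge> M" using big by (simp add: b_def)
    then have "a (Suc m) \<ge> a m + (M - C1)" using r(1)[of m] M(1) C0 by (simp add: abs_le_iff C1_def)
    then show ?case using Suc by (simp add: algebra_simps)
  qed
  have main: "gap * a m \<le> 20 * C1 * m + (4 * Y + \<bar>s 0 - 2 * b 0 - 2/3 * a 0\<bar> + C1)" for m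
  proof -
    have "s m \<le> lam * (a m + b m) + C1" using BB by (simp add: s_def a_def b_def)
    then have "2 * b m + 2/3 * a m + (s 0 - 2 * b 0 - 2/3 * a 0) - 20 * C1 * m \<le> lam * (a m + b m) + C1"
      using z[of m] by linarith
    moreover have "2 * b m + 2/3 * a m - lam * (a m + b m) = gap * a m + (2 - lam) * y m"
      by (simp add: gap_def y_def \<kappa>_def field_simps)
    moreover have "\<bar>(2 - lam) * y m\<bar> \<le> 2 * Y"
      unfolding abs_mult using yb[of m] lam lam_le by (intro mult_mono) auto
    moreover have "Y \<ge> 0" using C0 by (simp add: Y_def C1_def)
    ultimately show ?thesis by linarith
  qed
  have "gap * C1 \<le> gap * 10000 * C1" using gap C0 by (simp add: C1_def)
  then have "gap * (M - C1) \<ge> 20 * C1 + 1" using M(2) C0 by (simp add: C1_def)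
  then have growth: "real m * (20 * C1 + 1) \<le> real m * (gap * (M - C1))" for m
    by (intro mult_left_mono) auto
  have "gap * (real m * (M - C1)) \<le> gap * a m" for m
    using a_lin[of m] gap by (intro mult_left_mono) auto
  then have "real m * (20 * C1 + 1) \<le> gap * a m" for m
    using growth[of m] by (metis mult.left_commute order_trans)
  then have "real m * (20 * C1 + 1) \<le> 20 * C1 * m + (4 * Y + \<bar>s 0 - 2 * b 0 - 2/3 * a 0\<bar> + C1)" for m
    using main[of m] order_trans by blast
  then have "real m \<le> 4 * Y + \<bar>s 0 - 2 * b 0 - 2/3 * a 0\<bar> + C1" for m
    by (simp add: algebra_simps)
  then show False by (meson reals_Archimedean2 not_le)
qed

section \<open>From records to the recurrence\<close>

context record_sequence begin

lemma even_small:
  assumes "I 0 \<le> c"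
  shows "I (2 * k) \<le> c"
proof (induction k)
  case (Suc k)
  then show ?case using alternate1[OF alternate2[OF Suc]] by simp
qed (use assms in simp)

lemma J_ge_index: "k \<le> J k"
proof (induction k)
  case (Suc k)
  then show ?case using J_less[of k] by simp
qed simp

lemma contradiction:
  assumes start: "I 0 \<le> c" and lam: "0 < lam" "lam < 2/3 + 4 * sqrt 10 / 15"
  shows False
proof -
  \<comment> \<open>Odd indices are the runs far from the origin: q is the period of such a run and
    S its second position.\<close>
  define q where "q k = real (J (2 * k + 3)) - real (I (2 * k + 3))" for k
  define S where "S k = real (J (2 * k + 3))" for k
  define C where "C = 100 * (real c + real N0 + 1)"
  have small: "I (2 * k) \<le> c" "I (2 * k + 2) \<le> c" "I (2 * k + 4) \<le> c" for k
    using even_small[OF start, of k] even_small[OF start, of "k+1"] even_small[OF start, of "k+2"] by (simp_all add: numeral_eq_Suc)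
  have big: "I (2 * k + 3) > c" for k
    using alternate2[OF small(2)[of k]] by (simp add: numeral_3_eq_3)
  have near: "\<bar>real (I (2 * k + 5)) - real (J (2 * k + 3))\<bar> \<le> 2 * real c" for k
    using next_big[OF small(2)[of k]] by (simp add: abs_le_iff numeral_eq_Suc)
  \<comment> \<open>The first copies in a far record and in the next near record end together, and
    the length of the near one is the next J up to c + 1. So the length of a far factor is the sum
    of two consecutive periods.\<close>
  have Nq: "\<bar>q k + q (Suc k) - real (N (2 * k + 3))\<bar> \<le> 4 * real c + 1" for k
  proof -
    have "I (2 * k + 4) + N (2 * k + 4) = I (2 * k + 3) + N (2 * k + 3)"
      using small_length[OF big[of k]] by (simp add: numeral_eq_Suc)
    moreover have "N (2 * k + 4) < J (2 * k + 5)" "J (2 * k + 5) \<le> N (2 * k + 4) + 1 + c"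
      using J_greater[of "2 * k + 4"] J_le[of "2 * k + 4"] by (simp_all add: numeral_eq_Suc)
    moreover note small(3)[of k]
    ultimately have "\<bar>real (I (2 * k + 3)) + real (N (2 * k + 3)) - real (J (2 * k + 5))\<bar> \<le> 2 * real c + 1"
      by linarith
    moreover have "q (Suc k) = real (J (2 * k + 5)) - real (I (2 * k + 5))"
      by (simp add: q_def numeral_eq_Suc)
    ultimately show ?thesis using near[of k] unfolding q_def[of k] by linarith
  qed
  have JN: "\<bar>real (J (Suc k)) - real (N k)\<bar> \<le> real c + 1" for k
    using J_greater[of k] J_le[of k] by simp
  show False
  proof (rule recurrence_contradiction[OF lam])
    fix M :: real
    have "q k \<ge> M" if "k \<ge> nat \<lceil>5 * M\<rceil>" for k
    proof -
      have "5 * I (2 * k + 3) \<le> 4 * J (2 * k + 3)" using big_period_bound[OF big] .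
      then have "real (5 * I (2 * k + 3)) \<le> real (4 * J (2 * k + 3))" by (simp only: of_nat_le_iff)
      then have "5 * q k \<ge> real (J (2 * k + 3))" by (simp add: q_def)
      moreover have "real (J (2 * k + 3)) \<ge> real k" using J_ge_index[of "2 * k + 3"] by linarith
      moreover have "real k \<ge> 5 * M" using that by linarith
      ultimately show ?thesis by linarith
    qed
    then show "\<exists>K. \<forall>k\<ge>K. q k \<ge> M" by blast
  next
    fix k
    show "\<bar>S (Suc k) - S k - q (Suc k)\<bar> \<le> C"
      using near[of k] by (simp add: S_def q_def C_def numeral_eq_Suc)
  next
    fix k
    show "q (Suc k) + q k \<le> lam * S k + C"
      using Nq[of k] short[OF IJ ag, of "2 * k + 3"] by (simp add: S_def C_def)
  next
    fix k
    have "S (Suc k) \<le> real (N (2 * k + 4)) + 1 + c"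
      using J_le[of "2 * k + 4"] by (simp add: S_def numeral_eq_Suc)
    also have "real (N (2 * k + 4)) \<le> lam * real (J (2 * k + 4)) + real N0" using short[OF IJ ag] .
    also have "lam * real (J (2 * k + 4)) \<le> lam * (q k + q (Suc k) + 5 * real c + 2)"
      using Nq[of k] JN[of "2 * k + 3"] lam(1) by (intro mult_left_mono) (auto simp: numeral_eq_Suc abs_le_iff)
    also have "\<dots> = lam * (q k + q (Suc k)) + lam * (5 * real c + 2)" by (simp add: algebra_simps)
    also have "lam * (5 * real c + 2) \<le> 151/100 * (5 * real c + 2)"
      using lam_le by (intro mult_right_mono) auto
    finally show "S (Suc k) \<le> lam * (q k + q (Suc k)) + C" by (simp add: C_def field_simps)
  next
    fix k
    have "I (2 * k + 5) \<le> J (2 * k + 3) + 2 * c"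
      using next_big(1)[OF small(2)[of k]] by (simp add: numeral_eq_Suc)
    moreover have "J (2 * k + 3) \<le> N (2 * k + 2) + 1 + c"
      using J_le[of "2 * k + 2"] by (simp add: numeral_eq_Suc)
    moreover have "N (2 * k + 2) + 5 * c < N (2 * k + 3)"
      using gap[OF small(2)[of k]] by (simp add: numeral_eq_Suc)
    moreover have "N (2 * k + 3) < J (2 * k + 4)"
      using J_greater[of "2 * k + 3"] by (simp add: numeral_eq_Suc)
    ultimately have le: "I (Suc (2 * k + 4)) \<le> J (2 * k + 4)" by (simp add: numeral_eq_Suc)
    \<comment> \<open>Here J (2 * k + 5) and N (2 * k + 4) cancel up to c + 1, J (2 * k + 4) is
      close to N (2 * k + 3), and both remaining lengths are sums of two consecutive
      periods.\<close>
    obtain t where t: "t \<ge> 1" "J (2 * k + 5) + N (2 * k + 5) = J (2 * k + 4) + N (2 * k + 4)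
        + t * (J (2 * k + 5) - I (2 * k + 5))"
      using big_recurrence[OF small(3)[of k] le] by (auto simp: numeral_eq_Suc)
    have "real (J (2 * k + 5)) + real (N (2 * k + 5)) = real (J (2 * k + 4)) + real (N (2 * k + 4))
        + real t * q (Suc k)"
      using arg_cong[OF t(2), of real] IJ[of "2 * k + 5"] by (simp add: q_def of_nat_diff numeral_eq_Suc)
    moreover have a: "\<bar>real (J (2 * k + 5)) - real (N (2 * k + 4))\<bar> \<le> real c + 1"
      "\<bar>real (J (2 * k + 4)) - real (N (2 * k + 3))\<bar> \<le> real c + 1"
      "\<bar>q (Suc k) + q (Suc (Suc k)) - real (N (2 * k + 5))\<bar> \<le> 4 * real c + 1"
      using JN[of "2 * k + 4"] JN[of "2 * k + 3"] Nq[of "Suc k"] by (simp_all add: numeral_eq_Suc)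
    moreover note a[THEN abs_le_D1] a[THEN abs_le_D2] Nq[of k, THEN abs_le_D1] Nq[of k, THEN abs_le_D2]
    moreover have "10 * real c + 4 \<le> C" by (simp add: C_def)
    ultimately have "q (Suc (Suc k)) - real t * q (Suc k) - q k \<le> C"
      "- (q (Suc (Suc k)) - real t * q (Suc k) - q k) \<le> C"
      by linarith+
    then have "\<bar>q (Suc (Suc k)) - real t * q (Suc k) - q k\<bar> \<le> C" by (rule abs_leI)
    then show "\<exists>t::nat. t \<ge> 1 \<and> \<bar>q (Suc (Suc k)) - real t * q (Suc k) - q k\<bar> \<le> C" using t(1) by blast
  qed
qed

end

context repetitive_word begin

lemma contradiction_from_records:
  assumes lam: "0 < lam" "lam < 2/3 + 4 * sqrt 10 / 15"
  shows False
proof -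
  define T where "T = 1000 * c + 1000 * n0 + 1000 * N0 + 1000"
  define P where "P r \<longleftrightarrow> (case r of (i, j, n) \<Rightarrow> first_repeat i j n \<and> j \<ge> T)" for r
  define Q where "Q r r' \<longleftrightarrow> (case r of (i, j, n) \<Rightarrow> case r' of (i', j', n') \<Rightarrow> n < n' \<and> j' \<le> Suc n + c
      \<and> (\<forall>a b. a < b \<longrightarrow> agree s a b (Suc n) \<longrightarrow> j' \<le> b))" for r r' :: "nat \<times> nat \<times> nat"
  have ex: "\<exists>r. P r"
  proof -
    \<comment> \<open>By \<open>short\<close>, a length of at least 2 * T + N0 forces j to be at
      least T.\<close>
    obtain i j n where r: "first_repeat i j n" "2 * T + N0 \<le> n" using record_exists[of "2 * T + N0"] by blast
    then have "100 * n \<le> 151 * j + 100 * N0" using short_nat unfolding first_repeat_def by blast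
    then have "j \<ge> T" using r(2) by linarith
    then show ?thesis using r(1) unfolding P_def by blast
  qed
  have step: "\<exists>r'. P r' \<and> Q r r'" if Pr: "P r" for r
  proof -
    obtain i j n where r: "r = (i, j, n)" by (cases r) auto
    obtain i' j' n' where r': "first_repeat i' j' n'" "Suc n \<le> n'" "j' \<le> Suc n + c"
        "\<forall>a b. a < b \<longrightarrow> agree s a b (Suc n) \<longrightarrow> j' \<le> b"
      using record_exists[of "Suc n"] by blast
    have "i' < j'" "agree s i' j' (Suc n)"
      using r'(1,2) agree_mono unfolding first_repeat_def by blast+
    then have "j < j'" using Pr unfolding P_def r first_repeat_def by blast
    then have "P (i', j', n') \<and> Q r (i', j', n')" using Pr r' unfolding P_def Q_def r by auto
    then show ?thesis by blast
  qed
  obtain f where f: "\<And>k. P (f k)" "\<And>k. Q (f k) (f (Suc k))"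
    using dependent_nat_choice[of "\<lambda>_. P" "\<lambda>_. Q"] ex step by blast
  define I where "I k = fst (f k)" for k
  define J where "J k = fst (snd (f k))" for k
  define N where "N k = snd (snd (f k))" for k
  have fe: "f k = (I k, J k, N k)" for k by (simp add: I_def J_def N_def)
  have seq: "record_sequence s c n0 N0 lam (\<lambda>k. I (k + r)) (\<lambda>k. J (k + r)) (\<lambda>k. N (k + r))" for r
  proof (unfold_locales)
    fix k
    show "first_repeat (I (k + r)) (J (k + r)) (N (k + r))"
      "1000 * c + 1000 * n0 + 1000 * N0 + 1000 \<le> J (k + r)"
      using f(1)[of "k + r"] by (auto simp: P_def fe T_def)
    show "N (k + r) < N (Suc k + r)" "J (Suc k + r) \<le> Suc (N (k + r)) + c"
      using f(2)[of "k + r"] by (auto simp: Q_def fe)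
    show "J (Suc k + r) \<le> b" if "a < b" "agree s a b (Suc (N (k + r)))" for a b
      using f(2)[of "k + r"] that by (auto simp: Q_def fe)
  qed
  show False
  \<comment> \<open>Dropping the first record if necessary makes the sequence start near the origin,
    which fixes the parity.\<close>
  proof (cases "I 0 \<le> c")
    case True
    then show False using record_sequence.contradiction[OF seq[of 0]] lam by simp
  next
    case False
    then have "I 1 \<le> c" using record_sequence.alternate1[OF seq[of 0], of 0] by simp
    then show False using record_sequence.contradiction[OF seq[of 1]] lam by simp
  qed
qed

end

section \<open>Factor complexity\<close>

text \<open>Positions are counted from 0, so position 0 holds the letter s 1 and every natural
  number is an admissible start.\<close>

definition factor_at :: "(nat \<Rightarrow> nat) \<Rightarrow> nat \<Rightarrow> nat \<Rightarrow> nat list" where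
  "factor_at s n x = map (\<lambda>i. s (Suc x + i)) [0..<n]"

lemma factors_eq_range: "factors s n = range (factor_at s n)"
proof -
  have "factors s n = (\<lambda>k. map (\<lambda>i. s (k + i)) [0..<n]) ` {1..}" by (auto simp: factors_def)
  also have "{1..} = range Suc" by (auto simp: image_iff) (metis Suc_le_D)
  finally show ?thesis by (simp add: image_image factor_at_def[abs_def])
qed

lemma factor_at_eq_iff: "factor_at s n i = factor_at s n j \<longleftrightarrow> agree (\<lambda>x. s (Suc x)) i j n"
  by (auto simp: factor_at_def agree_def)

lemma butlast_factor_at: "butlast (factor_at s (Suc n) x) = factor_at s n x"
  by (simp add: factor_at_def)

lemma finite_factors:
  assumes "word_over b s"
  shows "finite (factors s n)"
proof -
  have "factors s n \<subseteq> {xs. set xs \<subseteq> {..<b} \<and> length xs = n}"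
    using assms by (auto simp: factors_eq_range factor_at_def word_over_def)
  then show ?thesis using finite_lists_length_eq[of "{..<b}" n] finite_subset by blast
qed

lemma complexity_pigeonhole:
  assumes "word_over b s"
  shows "\<exists>i j. i < j \<and> j \<le> complexity s n \<and> agree (\<lambda>x. s (Suc x)) i j n"
proof -
  have "factor_at s n ` {..complexity s n} \<subseteq> factors s n" by (auto simp: factors_eq_range)
  then have "card (factor_at s n ` {..complexity s n}) \<le> complexity s n"
    unfolding complexity_def using finite_factors[OF assms] card_mono by blast
  then have "\<not> inj_on (factor_at s n) {..complexity s n}"
    by (intro pigeonhole) simp
  then obtain i j where ij: "i \<noteq> j" "i \<le> complexity s n" "j \<le> complexity s n" "factor_at s n i = factor_at s n j"
    by (auto simp: inj_on_def)
  then consider "i < j" | "j < i" by linarith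
  then show ?thesis
  proof cases
    case 1
    then show ?thesis using ij factor_at_eq_iff by blast
  next
    case 2
    then show ?thesis using ij factor_at_eq_iff[of s n j i] by auto
  qed
qed

text \<open>Choose one right extension e w for each factor w. Each of the two right special factors
  has a second extension outside the image of e, and these two differ because their prefixes
  do.\<close>

lemma two_right_special_factors:
  assumes "word_over b s"
    and ij: "agree (\<lambda>x. s (Suc x)) i j n" "s (Suc (i + n)) \<noteq> s (Suc (j + n))"
    and ij': "agree (\<lambda>x. s (Suc x)) i' j' n" "s (Suc (i' + n)) \<noteq> s (Suc (j' + n))"
    and ne: "\<not> agree (\<lambda>x. s (Suc x)) i i' n"
  shows "complexity s (Suc n) \<ge> complexity s n + 2"
proof -
  define e where "e w = factor_at s (Suc n) (SOME x. factor_at s n x = w)" for w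
  have be: "butlast (e w) = w" if "w \<in> factors s n" for w
  proof -
    have "factor_at s n (SOME x. factor_at s n x = w) = w"
      using that by (intro someI_ex[of "\<lambda>x. factor_at s n x = w"]) (auto simp: factors_eq_range)
    then show ?thesis by (simp add: e_def butlast_factor_at)
  qed
  have extra: "\<exists>u \<in> factors s (Suc n). butlast u = factor_at s n i \<and> u \<notin> e ` factors s n"
    if "agree (\<lambda>x. s (Suc x)) i j n" "s (Suc (i + n)) \<noteq> s (Suc (j + n))" for i j
  proof -
    have eq: "factor_at s n j = factor_at s n i"
      using factor_at_eq_iff[of s n i j] that(1) by simp
    have "factor_at s (Suc n) i \<noteq> factor_at s (Suc n) j"
      using that unfolding factor_at_eq_iff agree_Suc by simp
    then have "factor_at s (Suc n) i \<noteq> e (factor_at s n i) \<or> factor_at s (Suc n) j \<noteq> e (factor_at s n i)"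
      by auto
    then obtain y where y: "y = i \<or> y = j" "factor_at s (Suc n) y \<noteq> e (factor_at s n i)" by blast
    have b: "butlast (factor_at s (Suc n) y) = factor_at s n i"
      using y(1) eq by (auto simp: butlast_factor_at)
    have "factor_at s (Suc n) y \<notin> e ` factors s n"
    proof
      assume "factor_at s (Suc n) y \<in> e ` factors s n"
      then obtain w where w: "w \<in> factors s n" "factor_at s (Suc n) y = e w" by blast
      then have "w = factor_at s n i" using be[OF w(1)] b by simp
      then show False using w(2) y(2) by simp
    qed
    then show ?thesis using b unfolding factors_eq_range by blast
  qed
  obtain u where u: "u \<in> factors s (Suc n)" "butlast u = factor_at s n i" "u \<notin> e ` factors s n"
    using extra[OF ij] by blast
  obtain u' where u': "u' \<in> factors s (Suc n)" "butlast u' = factor_at s n i'" "u' \<notin> e ` factors s n"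
    using extra[OF ij'] by blast
  have "u \<noteq> u'" using u(2) u'(2) ne factor_at_eq_iff[of s n i i'] by auto
  have fin: "finite (factors s n)" "finite (factors s (Suc n))" using finite_factors[OF assms(1)] by auto
  have inj: "inj_on e (factors s n)" using be by (rule inj_on_inverseI)
  have "insert u (insert u' (e ` factors s n)) \<subseteq> factors s (Suc n)"
    using u(1) u'(1) by (auto simp: e_def factors_eq_range)
  then have "card (insert u (insert u' (e ` factors s n))) \<le> complexity s (Suc n)"
    unfolding complexity_def using fin(2) card_mono by blast
  moreover have "card (insert u (insert u' (e ` factors s n))) = complexity s n + 2"
    using u(3) u'(3) \<open>u \<noteq> u'\<close> fin(1) card_image[OF inj] by (simp add: complexity_def)
  ultimately show ?thesis by simp
qed

text \<open>Subtracting p repeatedly moves every occurrence to a start below M + p.\<close>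

lemma complexity_eventually_periodic:
  assumes "word_over b s" "p > 0" "\<And>x. x \<ge> M \<Longrightarrow> s (Suc (x + p)) = s (Suc x)"
  shows "complexity s n \<le> M + p"
proof -
  have red: "factor_at s n x \<in> factor_at s n ` {..<M + p}" for x
  proof (induction x rule: less_induct)
    case (less x)
    show ?case
    proof (cases "x < M + p")
      case False
      have "factor_at s n (x - p) = factor_at s n x"
        unfolding factor_at_eq_iff agree_def
      proof (intro allI impI)
        fix y
        have "s (Suc (x - p + y + p)) = s (Suc (x - p + y))" using False by (intro assms(3)) auto
        moreover have "x - p + y + p = x + y" using False by simp
        ultimately show "s (Suc (x - p + y)) = s (Suc (x + y))" by simp
      qed
      then show ?thesis using less.IH[of "x - p"] False assms(2) by simp
    qed simp
  qed
  have "factors s n \<subseteq> factor_at s n ` {..<M + p}" using red by (auto simp: factors_eq_range)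
  then have "card (factors s n) \<le> card (factor_at s n ` {..<M + p})" by (intro card_mono) auto
  also have "\<dots> \<le> card {..<M + p}" by (rule card_image_le) simp
  finally show ?thesis by (simp add: complexity_def)
qed

section \<open>Lower bound for the irrationality exponent\<close>

text \<open>Reducing a fraction only enlarges the permitted error, so P and Q need not be coprime.
  Infinitely many reduced fractions arise because the nonzero errors have no positive lower
  bound.\<close>

lemma irrationality_exponent_geI:
  assumes m: "0 \<le> m" and approx: "\<And>\<epsilon>. \<epsilon> > 0 \<Longrightarrow> \<exists>P Q. (0::int) < Q \<and>
      \<xi> \<noteq> real_of_int P / real_of_int Q \<and> \<bar>\<xi> - real_of_int P / real_of_int Q\<bar> < \<epsilon>
        \<and> \<bar>\<xi> - real_of_int P / real_of_int Q\<bar> < real_of_int Q powr (- m)"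
  shows "irrationality_exponent \<xi> \<ge> ereal m"
proof -
  let ?A = "{(p::int, q::int). q > 0 \<and> coprime p q \<and> \<bar>\<xi> - p / q\<bar> < q powr (- m)}"
  have "infinite ?A"
  proof
    assume fin: "finite ?A"
    \<comment> \<open>The element 1 keeps D nonempty, and 0 is removed since a fraction equal to
      \<xi> would make the minimum useless.\<close>
    define D where "D = insert 1 ((\<lambda>(p, q). \<bar>\<xi> - p / q\<bar>) ` ?A - {0})"
    have finD: "finite D" using fin by (simp add: D_def)
    have "Min D \<in> D" using finD by (intro Min_in) (auto simp: D_def)
    then have "Min D > 0" by (auto simp: D_def)
    then obtain P Q :: int where PQ: "Q > 0" "\<xi> \<noteq> P / Q" "\<bar>\<xi> - P / Q\<bar> < Min D" "\<bar>\<xi> - P / Q\<bar> < Q powr (- m)"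
      using approx by blast
    define g where "g = gcd P Q"
    define p where "p = P div g"
    define q where "q = Q div g"
    have g: "g > 0" using PQ(1) by (simp add: g_def)
    have e: "P = g * p" "Q = g * q" by (simp_all add: p_def q_def g_def)
    have cop: "coprime p q" using PQ(1) unfolding p_def q_def g_def by (intro div_gcd_coprime) auto
    have q0: "q > 0" using e(2) g PQ(1) by (metis zero_less_mult_pos)
    have frac: "real_of_int P / Q = p / q" using g by (simp add: e)
    have "q \<le> Q" using g q0 unfolding e(2) by (simp add: mult_le_cancel_right1)
    then have "Q powr (- m) \<le> q powr (- m)" using q0 m by (intro powr_mono2') auto
    then have "(p, q) \<in> ?A" using PQ(4) cop q0 unfolding frac by auto
    then have "\<bar>\<xi> - p / q\<bar> \<in> D" using PQ(2) unfolding D_def frac by force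
    then have "Min D \<le> \<bar>\<xi> - p / q\<bar>" using finD by simp
    then show False using PQ(3) unfolding frac by simp
  qed
  then show ?thesis unfolding irrationality_exponent_def by (intro Sup_upper) blast
qed

section \<open>Shifts of a digit expansion and the approximations given by repetitions\<close>

locale digit_word =
  fixes b :: nat and s :: "nat \<Rightarrow> nat"
  assumes b: "b \<ge> 2" and digits: "word_over b s"
begin

text \<open>The value of the word without its first x letters. It may equal 1, so it is not always a
  fractional part.\<close>

definition tail :: "nat \<Rightarrow> real" where
  "tail x = (\<Sum>j. real (s (Suc (x + j))) / real b ^ Suc j)"

lemma tail_summable: "summable (\<lambda>j. real (s (Suc (x + j))) / real b ^ Suc j)"
proof (rule summable_comparison_test)
  show "\<exists>N. \<forall>n\<ge>N. norm (real (s (Suc (x + n))) / real b ^ Suc n) \<le> (1 / real b) ^ n"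
  proof (intro exI allI impI)
    fix n
    have "s (Suc (x + n)) < b" using digits by (simp add: word_over_def)
    then have "real (s (Suc (x + n))) / real b ^ Suc n \<le> real b / real b ^ Suc n"
      by (intro divide_right_mono) auto
    also have "\<dots> = (1 / real b) ^ n" using b by (simp add: power_one_over field_simps)
    finally show "norm (real (s (Suc (x + n))) / real b ^ Suc n) \<le> (1 / real b) ^ n" by simp
  qed
  show "summable (\<lambda>n. (1 / real b) ^ n)" using b by (intro summable_geometric) auto
qed

lemma tail_0: "tail 0 = word_value b s"
  by (simp add: tail_def word_value_def)

lemma tail_step: "tail (Suc x) = real b * tail x - real (s (Suc x))"
proof -
  have "tail x = (\<Sum>j. real (s (Suc (x + Suc j))) / real b ^ Suc (Suc j)) + real (s (Suc x)) / real b"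
    unfolding tail_def using suminf_split_initial_segment[OF tail_summable[of x], of 1] by simp
  also have "(\<Sum>j. real (s (Suc (x + Suc j))) / real b ^ Suc (Suc j))
      = (\<Sum>j. (1 / real b) * (real (s (Suc (Suc x + j))) / real b ^ Suc j))" by simp
  also have "\<dots> = tail (Suc x) / real b"
    unfolding tail_def by (subst suminf_mult[OF tail_summable]) simp
  finally show ?thesis using b by (simp add: field_simps)
qed

lemma tail_nonneg: "tail x \<ge> 0"
  unfolding tail_def by (intro suminf_nonneg tail_summable) auto

lemma tail_le_1: "tail x \<le> 1"
proof -
  have geo: "(\<lambda>j. (real b - 1) / real b * (1 / real b) ^ j) sums ((real b - 1) / real b * (1 / (1 - 1 / real b)))"
    using b by (intro sums_mult geometric_sums) auto
  have "tail x \<le> (\<Sum>j. (real b - 1) / real b * (1 / real b) ^ j)"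
    unfolding tail_def
  proof (rule suminf_le[OF _ tail_summable])
    show "summable (\<lambda>j. (real b - 1) / real b * (1 / real b) ^ j)" using geo by (rule sums_summable)
    fix j
    have "s (Suc (x + j)) < b" using digits by (simp add: word_over_def)
    then have "real (s (Suc (x + j))) \<le> real b - 1" by linarith
    then have "real (s (Suc (x + j))) / real b ^ Suc j \<le> (real b - 1) / real b ^ Suc j"
      by (intro divide_right_mono) auto
    also have "\<dots> = (real b - 1) / real b * (1 / real b) ^ j" by (simp add: power_one_over)
    finally show "real (s (Suc (x + j))) / real b ^ Suc j \<le> (real b - 1) / real b * (1 / real b) ^ j" .
  qed
  also have "\<dots> = (real b - 1) / real b * (1 / (1 - 1 / real b))" using geo by (rule sums_unique[symmetric])
  also have "\<dots> = 1" using b by (simp add: field_simps)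
  finally show ?thesis .
qed

lemma tail_eq_mod_Ints: "\<exists>P::int. real b ^ x * word_value b s - tail x = P"
proof (induction x)
  case 0
  show ?case by (rule exI[of _ 0]) (simp add: tail_0)
next
  case (Suc x)
  then obtain P :: int where P: "real b ^ x * word_value b s - tail x = P" by blast
  have "real b ^ Suc x * word_value b s - tail (Suc x) = real b * P + real (s (Suc x))"
    unfolding P[symmetric] tail_step by (simp add: algebra_simps)
  also have "\<dots> = real_of_int (int b * P + int (s (Suc x)))" by simp
  finally show ?case by blast
qed

lemma agree_tail:
  assumes "agree (\<lambda>x. s (Suc x)) i j n"
  shows "tail i - tail j = (tail (i + n) - tail (j + n)) / real b ^ n"
  using assms
proof (induction n)
  case (Suc n)
  then have "tail i - tail j = (tail (i + n) - tail (j + n)) / real b ^ n"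
    and "s (Suc (i + n)) = s (Suc (j + n))" by (simp_all add: agree_Suc)
  moreover from this(2) have "tail (i + Suc n) - tail (j + Suc n) = real b * (tail (i + n) - tail (j + n))"
    by (simp add: tail_step algebra_simps)
  ultimately show ?case using b by simp
qed simp

lemma tail_zero_constant:
  assumes "tail y = 0"
  shows "s (Suc (y + x)) = 0"
proof -
  have "tail (y + x) = 0 \<and> s (Suc (y + x)) = 0"
  proof (induction x)
    case 0
    show ?case using assms tail_step[of y] tail_nonneg[of "Suc y"] by simp
  next
    case (Suc x)
    then have "tail (y + Suc x) = 0" using tail_step[of "y + x"] by simp
    then show ?case using tail_step[of "y + Suc x"] tail_nonneg[of "Suc (y + Suc x)"] by simp
  qed
  then show ?thesis by blast
qed

text \<open>All tails lie in the finite set of multiples of 1 / v in [0, 1], so two of them are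
  equal. Equal tails need not have equal digits, because an expansion ending in zeros has a twin;
  the second case treats this.\<close>

lemma eventually_periodic_of_rational:
  assumes "word_value b s \<in> \<rat>"
  shows "\<exists>M p. p > 0 \<and> (\<forall>x\<ge>M. s (Suc (x + p)) = s (Suc x))"
proof -
  obtain u v :: int where v: "v > 0" and uv: "word_value b s = u / v"
    using assms by (metis Rats_cases')
  have int: "\<exists>k::int. 0 \<le> k \<and> k \<le> v \<and> tail x = k / v" for x
  proof -
    obtain P :: int where P: "real b ^ x * word_value b s - tail x = P" using tail_eq_mod_Ints by blast
    define k where "k = int b ^ x * u - P * v"
    have k: "tail x = k / v" using P v by (simp add: uv k_def field_simps)
    have "0 \<le> k" using tail_nonneg[of x] v unfolding k by (simp add: zero_le_divide_iff)
    moreover have "k \<le> v" using tail_le_1[of x] v unfolding k by (simp add: divide_le_eq_1)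
    ultimately show ?thesis using k by blast
  qed
  have "range tail \<subseteq> (\<lambda>k::int. k / v) ` {0..v}" using int by fastforce
  then have "finite (range tail)" using finite_subset by blast
  then have "\<not> inj tail" using finite_imageD infinite_UNIV_nat by blast
  then obtain i j where ij: "i < j" "tail i = tail j" by (metis injI linorder_neqE_nat)
  show ?thesis
  proof (cases "\<forall>n. agree (\<lambda>x. s (Suc x)) i j n")
    case True
    have "s (Suc (x + (j - i))) = s (Suc x)" if "x \<ge> i" for x
      using agreeD[OF True[rule_format, of "Suc x"], of x "x + (j - i)"] that ij(1) by auto
    then show ?thesis using ij(1) zero_less_diff by blast
  next
    case False
    then obtain n where n: "\<not> agree (\<lambda>x. s (Suc x)) i j n" "\<And>m. m < n \<Longrightarrow> agree (\<lambda>x. s (Suc x)) i j m"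
      using exists_least_iff[of "\<lambda>n. \<not> agree (\<lambda>x. s (Suc x)) i j n"] by blast
    have "n \<noteq> 0" using n(1) by (auto simp: agree_def)
    then obtain m where m: "n = Suc m" using not0_implies_Suc by blast
    have a: "agree (\<lambda>x. s (Suc x)) i j m" using n(2) m by simp
    have ne: "s (Suc (i + m)) \<noteq> s (Suc (j + m))" using n(1) a unfolding m agree_Suc by simp
    have "tail (i + m) = tail (j + m)" using agree_tail[OF a] ij(2) b by simp
    then have d: "tail (Suc (i + m)) - tail (Suc (j + m)) = real (s (Suc (j + m))) - real (s (Suc (i + m)))"
      by (simp add: tail_step)
    \<comment> \<open>Two numbers in [0, 1] that differ by a nonzero integer are 0 and 1.\<close>
    have "tail (Suc (i + m)) = 0 \<or> tail (Suc (j + m)) = 0"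
      using d ne tail_nonneg[of "Suc (i + m)"] tail_nonneg[of "Suc (j + m)"]
        tail_le_1[of "Suc (i + m)"] tail_le_1[of "Suc (j + m)"] by linarith
    then obtain y where y: "tail y = 0" by blast
    have "s (Suc (x + 1)) = s (Suc x)" if "x \<ge> y" for x
      using tail_zero_constant[OF y, of "x - y"] tail_zero_constant[OF y, of "Suc x - y"] that by simp
    then show ?thesis using zero_less_one by blast
  qed
qed

text \<open>Multiplying by b^j - b^i leaves an integer plus tail j - tail i, which n common digits
  make at most b^(-n). The surplus N makes these errors arbitrarily small.\<close>

lemma exponent_ge_of_repetitions:
  assumes irr: "word_value b s \<notin> \<rat>" and lam: "0 \<le> lam"
    and rep: "\<And>N::nat. \<exists>i j n. i < j \<and> agree (\<lambda>x. s (Suc x)) i j n \<and> real n > lam * real j + N"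
  shows "irrationality_exponent (word_value b s) \<ge> ereal (1 + lam)"
proof (rule irrationality_exponent_geI)
  show "0 \<le> 1 + lam" using lam by simp
  fix \<epsilon> :: real assume "\<epsilon> > 0"
  let ?\<xi> = "word_value b s"
  have b1: "real b > 1" using b by simp
  obtain N where N: "(1 / real b) ^ N < \<epsilon>"
    using real_arch_pow_inv[OF \<open>\<epsilon> > 0\<close>, of "1 / real b"] b1 by auto
  obtain i j n where ij: "i < j" "agree (\<lambda>x. s (Suc x)) i j n" "real n > lam * real j + N"
    using rep by blast
  obtain Pi Pj :: int where P: "real b ^ i * ?\<xi> - tail i = Pi" "real b ^ j * ?\<xi> - tail j = Pj"
    using tail_eq_mod_Ints by metis
  define Q where "Q = int b ^ j - int b ^ i"
  have Qr: "real_of_int Q = real b ^ j - real b ^ i" by (simp add: Q_def)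
  have "real b ^ i < real b ^ j" using b1 ij(1) by (intro power_strict_increasing) auto
  then have Q0: "real_of_int Q > 0" unfolding Qr by simp
  then have Q1: "real_of_int Q \<ge> 1" by (simp add: int_one_le_iff_zero_less)
  have QP: "Q * ?\<xi> - (Pj - Pi) = tail j - tail i" unfolding Qr using P by (simp add: algebra_simps)
  have dist: "\<bar>?\<xi> - (Pj - Pi) / Q\<bar> = \<bar>tail i - tail j\<bar> / Q"
  proof -
    have "?\<xi> - (Pj - Pi) / Q = (Q * ?\<xi> - (Pj - Pi)) / Q" using Q0 by (simp add: field_simps)
    then show ?thesis using QP Q0 by (simp add: abs_minus_commute)
  qed
  have "\<bar>tail (i + n) - tail (j + n)\<bar> \<le> 1"
    using tail_nonneg[of "i+n"] tail_nonneg[of "j+n"] tail_le_1[of "i+n"] tail_le_1[of "j+n"] by linarith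
  then have tb: "\<bar>tail i - tail j\<bar> \<le> 1 / real b ^ n"
    using divide_right_mono[of _ 1 "real b ^ n"] b1 by (simp add: agree_tail[OF ij(2)])
  have "\<bar>?\<xi> - (Pj - Pi) / Q\<bar> \<le> 1 / real b ^ n"
  proof -
    have "\<bar>tail i - tail j\<bar> / Q \<le> \<bar>tail i - tail j\<bar> / 1" using Q1 by (intro divide_left_mono) auto
    then show ?thesis unfolding dist using tb by simp
  qed
  also have "\<dots> \<le> (1 / real b) ^ N"
  proof -
    have "lam * real j \<ge> 0" using lam by simp
    then have "N \<le> n" using ij(3) by linarith
    then show ?thesis using b1 by (simp add: power_one_over frac_le power_increasing)
  qed
  finally have small: "\<bar>?\<xi> - (Pj - Pi) / Q\<bar> < \<epsilon>" using N by simp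
  have "real_of_int Q powr lam \<le> (real b ^ j) powr lam"
    using lam Q0 by (intro powr_mono2) (auto simp: Qr)
  also have "\<dots> = real b powr (lam * real j)"
    using b1 by (simp add: powr_realpow[symmetric] powr_powr mult.commute)
  also have "\<dots> < real b powr real n" using ij(3) b1 by (intro powr_less_mono) auto
  also have "\<dots> = real b ^ n" using b1 by (simp add: powr_realpow)
  finally have "1 / real b ^ n < 1 / Q powr lam"
    using Q0 b1 by (intro divide_strict_left_mono mult_pos_pos) auto
  then have "\<bar>?\<xi> - (Pj - Pi) / Q\<bar> < (1 / Q powr lam) / Q"
    unfolding dist using tb Q0 by (intro divide_strict_right_mono) auto
  also have "\<dots> = Q powr (- (1 + lam))"
    using Q0 powr_add[of Q 1 lam] powr_minus_divide[of Q "1 + lam"] by (simp add: mult.commute)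
  finally have "\<bar>?\<xi> - (Pj - Pi) / Q\<bar> < Q powr (- (1 + lam))" .
  moreover have "?\<xi> \<noteq> real_of_int (Pj - Pi) / Q" using irr by auto
  ultimately show "\<exists>P Q. (0::int) < Q \<and> ?\<xi> \<noteq> real_of_int P / real_of_int Q
      \<and> \<bar>?\<xi> - real_of_int P / real_of_int Q\<bar> < \<epsilon> \<and> \<bar>?\<xi> - real_of_int P / real_of_int Q\<bar> < real_of_int Q powr (- (1 + lam))"
    using small Q0 by (intro exI[of _ "Pj - Pi"] exI[of _ Q]) auto
qed

theorem quasi_sturmian_exponent:
  assumes "quasi_sturmian s"
  shows "irrationality_exponent (word_value b s) \<ge> ereal (5/3 + 4 * sqrt 10 / 15)"
proof (rule ccontr)
  assume "\<not> ?thesis"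
  then have "irrationality_exponent (word_value b s) < ereal (5/3 + 4 * sqrt 10 / 15)" by simp
  then obtain z where z: "irrationality_exponent (word_value b s) < ereal z" "z < 5/3 + 4 * sqrt 10 / 15"
    using ereal_dense2 by force
  \<comment> \<open>Raising z - 1 to at least 1 keeps lam positive and still below the limit, while
    z <= 1 + lam preserves the contradiction with exponent 1 + lam.\<close>
  define lam where "lam = max 1 (z - 1)"
  have lam: "1 \<le> lam" "lam < 2/3 + 4 * sqrt 10 / 15" "z \<le> 1 + lam"
    using z(2) sqrt10_bounds by (auto simp: lam_def)
  have lam_le: "lam \<le> 151/100" using lam(2) sqrt10_bounds by simp
  obtain k n0 where k: "\<And>n. n \<ge> n0 \<Longrightarrow> int (complexity s n) = int n + k"
    using assms unfolding quasi_sturmian_def by blast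
  define c where "c = n0 + nat \<bar>k\<bar>"
  have irr: "word_value b s \<notin> \<rat>"
  proof
    assume "word_value b s \<in> \<rat>"
    then obtain M p where p: "p > 0" "\<And>x. x \<ge> M \<Longrightarrow> s (Suc (x + p)) = s (Suc x)"
      using eventually_periodic_of_rational by blast
    define n where "n = n0 + M + p + nat \<bar>k\<bar> + 1"
    have "complexity s n \<le> M + p" using complexity_eventually_periodic[OF digits p] by simp
    moreover have "int (complexity s n) = int n + k" by (rule k) (simp add: n_def)
    ultimately show False by (simp add: n_def)
  qed
  have "\<exists>N::nat. \<forall>i j n. i < j \<longrightarrow> agree (\<lambda>x. s (Suc x)) i j n \<longrightarrow> real n \<le> lam * real j + N"
  proof (rule ccontr)
    assume "\<not> ?thesis"
    then have "irrationality_exponent (word_value b s) \<ge> ereal (1 + lam)"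
      using lam(1) by (intro exponent_ge_of_repetitions irr) (auto simp: not_le)
    then have "ereal (1 + lam) < ereal z" using z(1) by (rule order.strict_trans1)
    then show False using lam(3) by simp
  qed
  then obtain N0 where N0: "\<And>i j n. i < j \<Longrightarrow> agree (\<lambda>x. s (Suc x)) i j n \<Longrightarrow> real n \<le> lam * real j + real N0"
    by blast
  interpret repetitive_word "\<lambda>x. s (Suc x)" c n0 N0 lam
  proof
    fix n
    show "\<exists>i j. i < j \<and> j \<le> n + c \<and> agree (\<lambda>x. s (Suc x)) i j n"
    proof -
      \<comment> \<open>The complexity formula is available only from n0 on, hence the length n +
        n0; the extra n0 is paid for in c.\<close>
      obtain i j where ij: "i < j" "j \<le> complexity s (n + n0)" "agree (\<lambda>x. s (Suc x)) i j (n + n0)"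
        using complexity_pigeonhole[OF digits] by blast
      have "int (complexity s (n + n0)) = int (n + n0) + k" by (rule k) simp
      then have "complexity s (n + n0) \<le> n + c" by (simp add: c_def)
      then show ?thesis using ij agree_mono[OF ij(3), of n] by (meson le_add1 order_trans)
    qed
  next
    fix n i j i' j'
    assume a: "n0 \<le> n" "agree (\<lambda>x. s (Suc x)) i j n" "s (Suc (i + n)) \<noteq> s (Suc (j + n))"
      "agree (\<lambda>x. s (Suc x)) i' j' n" "s (Suc (i' + n)) \<noteq> s (Suc (j' + n))"
    show "agree (\<lambda>x. s (Suc x)) i i' n"
    proof (rule ccontr)
      assume "\<not> agree (\<lambda>x. s (Suc x)) i i' n"
      then have "complexity s n + 2 \<le> complexity s (Suc n)"
        using two_right_special_factors[OF digits a(2-5)] by blast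
      moreover have "int (complexity s n) = int n + k" "int (complexity s (Suc n)) = int (Suc n) + k"
        using k[of n] k[of "Suc n"] a(1) by auto
      ultimately show False by linarith
    qed
  qed (use N0 lam_le in auto)
  show False using contradiction_from_records lam by simp
qed

end

section \<open>Chains of rational approximations\<close>

lemma le_powr_inverse:
  fixes x :: real
  assumes "0 < x" "0 < a" "x powr a \<le> K"
  shows "x \<le> K powr (1 / a)"
proof -
  have "(x powr a) powr (1 / a) \<le> K powr (1 / a)"
    using assms by (intro powr_mono2) auto
  then show ?thesis using assms by (simp add: powr_powr)
qed

lemma finite_bounded_fractions:
  fixes \<xi> m B :: real
  assumes "0 \<le> m"
    and bd: "\<And>p q. (0::int) < q \<Longrightarrow> \<bar>\<xi> - real_of_int p / real_of_int q\<bar> < real_of_int q powr (- m) \<Longrightarrow> real_of_int q \<le> B"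
  shows "finite {(p::int, q::int). q > 0 \<and> coprime p q \<and> \<bar>\<xi> - p / q\<bar> < q powr (- m)}"
proof (rule finite_subset)
  define K where "K = \<lceil>(\<bar>\<xi>\<bar> + 1) * B\<rceil>"
  show "{(p::int, q::int). q > 0 \<and> coprime p q \<and> \<bar>\<xi> - p / q\<bar> < q powr (- m)} \<subseteq> {- K..K} \<times> {0..\<lceil>B\<rceil>}"
  proof clarsimp
    fix p q :: int assume q: "0 < q" and c: "\<bar>\<xi> - p / q\<bar> < q powr (- m)"
    have qB: "q \<le> B" using bd[OF q c] .
    have "q powr (- m) \<le> q powr 0" using q assms(1) by (intro powr_mono) auto
    then have "\<bar>\<xi> - p / q\<bar> < 1" using c q by simp
    then have "\<bar>p / q\<bar> \<le> \<bar>\<xi>\<bar> + 1" by linarith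
    then have "\<bar>real_of_int p\<bar> \<le> (\<bar>\<xi>\<bar> + 1) * q" using q by (simp add: abs_divide pos_divide_le_eq)
    also have "\<dots> \<le> (\<bar>\<xi>\<bar> + 1) * B" using qB by (intro mult_left_mono) auto
    finally have "\<bar>real_of_int p\<bar> \<le> K" unfolding K_def using le_of_int_ceiling order_trans by blast
    then have "\<bar>p\<bar> \<le> K" by linarith
    moreover have "real_of_int q \<le> \<lceil>B\<rceil>" using qB le_of_int_ceiling[of B] by (rule order_trans)
    ultimately show "- K \<le> p \<and> p \<le> K \<and> q \<le> \<lceil>B\<rceil>" by linarith
  qed
qed simp

text \<open>The error of each approximation is, up to the factor b, the reciprocal of the bound for
  the next denominator. With such a chain the growth of Y alone decides the exponent.\<close>

locale approximation_chain =
  fixes b :: nat and \<xi> lam C :: real and Y :: "nat \<Rightarrow> nat"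
  assumes b: "b \<ge> 2" and lam: "lam > 1"
    and Y_unbounded: "\<And>m. m \<le> Y m"
    and approximants: "\<And>m. \<exists>(Q::int) (R::int). 1 \<le> Q \<and> Q \<le> int b ^ Y m
        \<and> 1 / real b ^ Y (Suc m) \<le> \<bar>Q * \<xi> - R\<bar> \<and> \<bar>Q * \<xi> - R\<bar> \<le> b / real b ^ Y (Suc m)"
    and ratio: "\<And>m. Y (Suc m) \<le> lam * Y m + C"
    and ratio_sharp: "\<And>n. \<exists>m\<ge>n. lam * Y m - C \<le> Y (Suc m)"
begin

lemma b1: "real b > 1" using b by simp

text \<open>Compare p / q with the approximant R / Q in whose range q lies. If they differ, 1 <= |p
  Q - q R| bounds q powr (m - 2); if they are equal, the lower error bound together with
  \<open>ratio\<close> bounds q powr (m - (1 + lam)). Both exponents are positive since m > 1 + lam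
  > 2.\<close>

lemma exponent_upper: "irrationality_exponent \<xi> \<le> ereal (1 + lam)"
  unfolding irrationality_exponent_def
proof (rule Sup_least, clarify, rule ccontr)
  fix m assume inf: "infinite {(p::int, q::int). q > 0 \<and> coprime p q \<and> \<bar>\<xi> - p / q\<bar> < q powr (- m)}"
    and "\<not> ereal m \<le> ereal (1 + lam)"
  then have m: "m > 1 + lam" by simp
  define K where "K = (2 * real b) powr (1 + lam) * real b powr C"
  define B where "B = Max {real b ^ Y 1, (4 * real b) powr (1 / (m - 2)), K powr (1 / (m - (1 + lam)))}"
  have B: "real b ^ Y 1 \<le> B" "(4 * real b) powr (1 / (m - 2)) \<le> B" "K powr (1 / (m - (1 + lam))) \<le> B"
    by (simp_all add: B_def)
  have "q \<le> B" if q: "q > 0" and c: "\<bar>\<xi> - p / q\<bar> < q powr (- m)" for p q :: int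
  proof -
    let ?q = "real_of_int q"
    have q1: "?q > 0" using q by simp
    \<comment> \<open>For the least such M, its validity makes q * |Q * \<xi> - R| at most 1/2, and
      its failure at M - 1 gives Q < 2 * b * q.\<close>
    define T where "T M \<longleftrightarrow> 2 * real b * ?q \<le> real b ^ Y (Suc M)" for M
    have "\<exists>M. T M"
    proof -
      obtain N where N: "2 * real b * ?q < real b ^ N" using real_arch_pow[OF b1] by blast
      have "real b ^ N \<le> real b ^ Y (Suc N)"
        using b1 Y_unbounded[of "Suc N"] by (intro power_increasing) auto
      then show ?thesis using N unfolding T_def by (intro exI[of _ N]) linarith
    qed
    then obtain M where M: "T M" "\<And>k. k < M \<Longrightarrow> \<not> T k"
      using exists_least_iff[of T] by blast
    show ?thesis
    proof (cases M)
      case 0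
      then have "2 * real b * ?q \<le> real b ^ Y 1" using M(1) by (simp add: T_def)
      moreover have "1 * ?q \<le> 2 * real b * ?q" using q1 b1 by (intro mult_right_mono) auto
      ultimately show ?thesis using B(1) by linarith
    next
      case (Suc k)
      have lo: "real b ^ Y M < 2 * real b * ?q" using M(2)[of k] Suc by (simp add: T_def)
      have hi: "2 * real b * ?q \<le> real b ^ Y (Suc M)" using M(1) by (simp add: T_def)
      obtain Q R :: int where Q: "1 \<le> Q" "Q \<le> int b ^ Y M" "1 / real b ^ Y (Suc M) \<le> \<bar>Q * \<xi> - R\<bar>"
          "\<bar>Q * \<xi> - R\<bar> \<le> b / real b ^ Y (Suc M)"
        using approximants by blast
      have Qb: "real_of_int Q \<le> real b ^ Y M" using Q(2) by (metis of_int_le_iff of_int_of_nat_eq of_int_power)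
      have Q1: "real_of_int Q \<ge> 1" using Q(1) by simp
      have qm: "?q * ?q powr (- m) = ?q powr (1 - m)" using q1 by (simp add: powr_diff powr_minus field_simps)
      show ?thesis
      proof (cases "p * Q = q * R")
        case False
        then have "1 \<le> \<bar>p * Q - q * R\<bar>" by linarith
        then have "1 \<le> \<bar>real_of_int (p * Q - q * R)\<bar>" by linarith
        also have "real_of_int (p * Q - q * R) = ?q * (Q * \<xi> - R) - Q * ?q * (\<xi> - p / q)"
          using q1 by (simp add: field_simps)
        also have "\<bar>\<dots>\<bar> \<le> \<bar>?q * (Q * \<xi> - R)\<bar> + \<bar>Q * ?q * (\<xi> - p / q)\<bar>" by (rule abs_triangle_ineq4)
        also have "\<bar>?q * (Q * \<xi> - R)\<bar> \<le> ?q * (b / real b ^ Y (Suc M))"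
          unfolding abs_mult using Q(4) q1 by (intro mult_mono) auto
        also have "\<dots> \<le> 1 / 2" using hi b1 by (simp add: field_simps)
        also have "\<bar>Q * ?q * (\<xi> - p / q)\<bar> \<le> real b ^ Y M * ?q * ?q powr (- m)"
          unfolding abs_mult using Qb Q1 q1 c by (intro mult_mono) auto
        also have "\<dots> \<le> (2 * real b * ?q) * (?q * ?q powr (- m))"
          unfolding mult.assoc[of "real b ^ Y M"] using lo q1 by (intro mult_right_mono) auto
        also have "\<dots> = 2 * real b * ?q powr (2 - m)"
          unfolding qm using q1 powr_add[of ?q 1 "1 - m"] by simp
        finally have "1 / 2 \<le> 2 * real b * ?q powr (2 - m)" by simp
        moreover have "?q powr (2 - m) = 1 / ?q powr (m - 2)" using powr_minus_divide[of ?q "m - 2"] by simp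
        ultimately have "?q powr (m - 2) \<le> 4 * real b" using q1 by (simp add: field_simps)
        then have "?q \<le> (4 * real b) powr (1 / (m - 2))"
          using q1 m lam by (intro le_powr_inverse) auto
        then show ?thesis using B(2) by linarith
      next
        case True
        then have pq: "real_of_int p / q = R / Q"
          using q1 Q1 by (simp add: field_simps) (metis mult.commute of_int_mult)
        have "\<bar>Q * \<xi> - R\<bar> = Q * \<bar>\<xi> - p / q\<bar>"
        proof -
          have "Q * \<xi> - R = Q * (\<xi> - p / q)" unfolding pq using Q1 by (simp add: field_simps)
          then show ?thesis using Q1 by (simp add: abs_mult)
        qed
        also have "\<dots> < Q * ?q powr (- m)" using c Q1 by (intro mult_strict_left_mono) auto
        also have "\<dots> \<le> real b ^ Y M * ?q powr (- m)" using Qb by (intro mult_right_mono) auto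
        finally have "1 / real b ^ Y (Suc M) < real b ^ Y M * ?q powr (- m)" using Q(3) by linarith
        then have "?q powr m < real b ^ Y M * real b ^ Y (Suc M)"
          using b1 q1 by (simp add: powr_minus field_simps)
        also have "\<dots> = real b powr (Y M + Y (Suc M))" using b1 by (simp add: powr_add powr_realpow)
        also have "\<dots> \<le> real b powr ((1 + lam) * Y M + C)"
          using ratio[of M] b1 by (intro powr_mono) (auto simp: algebra_simps)
        also have "\<dots> = (real b ^ Y M) powr (1 + lam) * real b powr C"
          unfolding powr_add[of _ _ C] using b1 by (simp add: powr_powr powr_realpow[symmetric] mult.commute)
        also have "\<dots> \<le> (2 * real b * ?q) powr (1 + lam) * real b powr C"
          using lo lam b1 by (intro mult_right_mono powr_mono2) auto
        also have "\<dots> = K * ?q powr (1 + lam)"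
          using q1 b1 powr_mult[of "2 * real b" ?q "1 + lam"] by (simp add: K_def)
        finally have "?q powr m / ?q powr (1 + lam) < K" using q1 by (simp add: divide_less_eq)
        then have "?q powr (m - (1 + lam)) < K" by (simp only: powr_diff)
        then have "?q \<le> K powr (1 / (m - (1 + lam)))"
          using q1 m by (intro le_powr_inverse) auto
        then show ?thesis using B(3) by linarith
      qed
    qed
  qed
  then have "finite {(p::int, q::int). q > 0 \<and> coprime p q \<and> \<bar>\<xi> - p / q\<bar> < q powr (- m)}"
    using m lam by (intro finite_bounded_fractions[where B = B]) auto
  then show False using inf by blast
qed

lemma exponent_lower_strict:
  assumes "0 \<le> l" "l < lam"
  shows "ereal (1 + l) \<le> irrationality_exponent \<xi>"
proof (rule irrationality_exponent_geI)
  show "0 \<le> 1 + l" using assms by simp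
  fix \<epsilon> :: real assume "\<epsilon> > 0"
  obtain N where N: "(1 / real b) ^ N < \<epsilon>"
    using real_arch_pow_inv[OF \<open>\<epsilon> > 0\<close>, of "1 / real b"] b1 by auto
  \<comment> \<open>From index n on, (lam - l) * Y M is at least C + 2; the 2 covers the factor b in
    the error bound and a strict inequality.\<close>
  define n where "n = N + nat \<lceil>(C + 2) / (lam - l)\<rceil>"
  obtain M where M: "M \<ge> n" "lam * Y M - C \<le> Y (Suc M)" using ratio_sharp by blast
  obtain Q R :: int where Q: "1 \<le> Q" "Q \<le> int b ^ Y M" "1 / real b ^ Y (Suc M) \<le> \<bar>Q * \<xi> - R\<bar>"
      "\<bar>Q * \<xi> - R\<bar> \<le> b / real b ^ Y (Suc M)"
    using approximants by blast
  have Qb: "real_of_int Q \<le> real b ^ Y M" using Q(2) by (metis of_int_le_iff of_int_of_nat_eq of_int_power)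
  have Q1: "real_of_int Q \<ge> 1" using Q(1) by simp
  have dist: "\<bar>\<xi> - R / Q\<bar> = \<bar>Q * \<xi> - R\<bar> / Q"
  proof -
    have "\<xi> - R / Q = (Q * \<xi> - R) / Q" using Q1 by (simp add: field_simps)
    then show ?thesis using Q1 by simp
  qed
  have pos: "\<bar>Q * \<xi> - R\<bar> > 0" using Q(3) b1 by (smt (verit) divide_pos_pos zero_less_power)
  have "real (Y M) \<ge> real n" using Y_unbounded[of M] M(1) by simp
  moreover have "real n \<ge> (C + 2) / (lam - l)" unfolding n_def by linarith
  ultimately have "(C + 2) / (lam - l) \<le> real (Y M)" by linarith
  then have "C + 2 \<le> (lam - l) * Y M" using assms by (simp add: pos_divide_le_eq mult.commute)
  then have big: "l * Y M + 2 \<le> Y (Suc M)" using M(2) by (simp add: algebra_simps)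
  have "real b ^ Suc N \<le> real b ^ Y (Suc M)"
    using b1 Y_unbounded[of "Suc M"] M(1) by (intro power_increasing) (auto simp: n_def)
  then have "b / real b ^ Y (Suc M) \<le> b / real b ^ Suc N" using b1 by (intro divide_left_mono) auto
  also have "\<dots> = (1 / real b) ^ N" using b1 by (simp add: power_one_over)
  finally have "\<bar>Q * \<xi> - R\<bar> < \<epsilon>" using Q(4) N by linarith
  moreover have "\<bar>Q * \<xi> - R\<bar> / Q \<le> \<bar>Q * \<xi> - R\<bar>"
    using Q1 pos by (simp add: divide_le_eq mult_le_cancel_left1)
  ultimately have small: "\<bar>\<xi> - R / Q\<bar> < \<epsilon>" unfolding dist by linarith
  have "real_of_int Q powr l \<le> (real b ^ Y M) powr l"
    using assms Qb Q1 by (intro powr_mono2) auto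
  also have "\<dots> = real b powr (l * Y M)"
    using b1 by (simp add: powr_realpow[symmetric] powr_powr mult.commute)
  also have "\<dots> < real b powr (real (Y (Suc M)) - 1)" using big b1 by (intro powr_less_mono) auto
  also have "\<dots> = real b ^ Y (Suc M) / b" using b1 by (simp add: powr_diff powr_realpow)
  finally have less: "Q powr l < real b ^ Y (Suc M) / b" .
  have "0 < Q powr l" using Q1 by simp
  then have "b / real b ^ Y (Suc M) < 1 / Q powr l"
    using less b1 by (simp add: field_simps)
  then have "\<bar>\<xi> - R / Q\<bar> < (1 / Q powr l) / Q"
    unfolding dist using Q(4) Q1 by (intro divide_strict_right_mono) auto
  also have "\<dots> = Q powr (- (1 + l))"
    using Q1 powr_add[of Q 1 l] powr_minus_divide[of Q "1 + l"] by (simp add: mult.commute)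
  finally have "\<bar>\<xi> - R / Q\<bar> < Q powr (- (1 + l))" .
  moreover have "\<xi> \<noteq> R / Q" using pos Q1 by auto
  ultimately have "Q > 0 \<and> \<xi> \<noteq> R / Q \<and> \<bar>\<xi> - R / Q\<bar> < \<epsilon> \<and> \<bar>\<xi> - R / Q\<bar> < Q powr (- (1 + l))"
    using small Q(1) by auto
  then show "\<exists>P Q. (0::int) < Q \<and> \<xi> \<noteq> real_of_int P / real_of_int Q
      \<and> \<bar>\<xi> - real_of_int P / real_of_int Q\<bar> < \<epsilon> \<and> \<bar>\<xi> - real_of_int P / real_of_int Q\<bar> < real_of_int Q powr (- (1 + l))"
    by blast
qed

lemma exponent_eq: "irrationality_exponent \<xi> = ereal (1 + lam)"
proof (rule antisym[OF exponent_upper], rule ccontr)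
  assume "\<not> ereal (1 + lam) \<le> irrationality_exponent \<xi>"
  then obtain z where z: "irrationality_exponent \<xi> < ereal z" "z < 1 + lam"
    using ereal_dense2[of "irrationality_exponent \<xi>" "ereal (1 + lam)"] by (auto simp: not_le)
  have "ereal (1 + max 0 (z - 1)) \<le> irrationality_exponent \<xi>"
    using z(2) lam by (intro exponent_lower_strict) auto
  then have "ereal (1 + max 0 (z - 1)) < ereal z" using z(1) by (rule order.strict_trans1)
  then show False by simp
qed

end

section \<open>The extremal word\<close>

definition slope :: real where "slope = (sqrt 10 - 2) / 3"
definition intercept :: real where "intercept = (sqrt 10 - 1) / 3"

text \<open>The partial quotients of the slope. The intercept is chosen so that its Ostrowski expansion has
  all digits equal to 1: intercept - 1 is minus the sum of all denom j * slope - numer j.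
  Hence offset k is, up to sign, the tail of this series.\<close>

definition quot :: "nat \<Rightarrow> nat" where "quot k = (if k mod 3 = 0 then 2 else 1)"

fun denom :: "nat \<Rightarrow> nat" where
  "denom 0 = 1"
| "denom (Suc 0) = 2"
| "denom (Suc (Suc k)) = quot (Suc k) * denom (Suc k) + denom k"

fun numer :: "nat \<Rightarrow> nat" where
  "numer 0 = 0"
| "numer (Suc 0) = 1"
| "numer (Suc (Suc k)) = quot (Suc k) * numer (Suc k) + numer k"

definition denom_sum :: "nat \<Rightarrow> nat" where "denom_sum k = (\<Sum>j\<le>k. denom j)"
definition numer_sum :: "nat \<Rightarrow> nat" where "numer_sum k = (\<Sum>j\<le>k. numer j)"

text \<open>The convergents lie alternately below and above the slope; the sign makes all values
  positive.\<close>

definition err :: "nat \<Rightarrow> real" where "err k = (-1) ^ k * (denom k * slope - numer k)"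

definition offset :: "nat \<Rightarrow> real" where
  "offset k = (-1) ^ k * (denom_sum k * slope + intercept - numer_sum k - 1)"

lemma quot_mod_3 [simp]: "quot (3 * m) = 2" "quot (Suc (3 * m)) = 1" "quot (Suc (Suc (3 * m))) = 1"
  by (simp_all add: quot_def) presburger+

section \<open>Continued fraction and Ostrowski arithmetic of the slope\<close>

lemma quot_ge_1: "quot k \<ge> 1" by (simp add: quot_def)

lemma denom_pos: "denom k > 0"
  by (induction k rule: denom.induct) auto

lemma denom_sum_Suc: "denom_sum (Suc k) = denom_sum k + denom (Suc k)"
  by (simp add: denom_sum_def)

lemma denom_sum_less: "denom_sum k < denom (Suc (Suc k))"
proof (induction k)
  case 0
  show ?case by (simp add: denom_sum_def quot_def)
next
  case (Suc k)
  have "denom (Suc k) + denom (Suc (Suc k)) \<le> denom (Suc (Suc (Suc k)))"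
    using quot_ge_1[of "Suc (Suc k)"] by simp
  then show ?case using Suc denom_sum_Suc[of k] by linarith
qed

lemma determinant: "int (denom k) * int (numer (Suc k)) - int (denom (Suc k)) * int (numer k) = (-1) ^ k"
proof (induction k)
  case (Suc k)
  have "int (denom (Suc k)) * int (numer (Suc (Suc k))) - int (denom (Suc (Suc k))) * int (numer (Suc k))
     = - (int (denom k) * int (numer (Suc k)) - int (denom (Suc k)) * int (numer k))"
    by (simp add: algebra_simps)
  then show ?case using Suc by simp
qed simp

text \<open>The determinant is 1 or -1, so the two vectors form a basis of the integer lattice; u
  and v come from Cramer's rule.\<close>

lemma lattice_decomposition:
  fixes n m :: int
  shows "\<exists>u v :: int. n = u * int (denom k) + v * int (denom (Suc k)) \<and> m = u * int (numer k) + v * int (numer (Suc k))"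
proof -
  define \<delta> :: int where "\<delta> = (-1) ^ k"
  have \<delta>: "\<delta> * \<delta> = 1" by (simp add: \<delta>_def power_mult_distrib[symmetric])
  define u where "u = \<delta> * (n * numer (Suc k) - m * denom (Suc k))"
  define v where "v = \<delta> * (m * denom k - n * numer k)"
  have d: "int (denom k) * int (numer (Suc k)) - int (denom (Suc k)) * int (numer k) = \<delta>"
    using determinant by (simp add: \<delta>_def)
  have "u * denom k + v * denom (Suc k)
      = \<delta> * n * (int (denom k) * int (numer (Suc k)) - int (denom (Suc k)) * int (numer k))"
    by (simp add: u_def v_def algebra_simps)
  then have "u * denom k + v * denom (Suc k) = n" unfolding d using \<delta> by (simp add: mult.commute mult.left_commute)
  moreover have "u * numer k + v * numer (Suc k)
      = \<delta> * m * (int (denom k) * int (numer (Suc k)) - int (denom (Suc k)) * int (numer k))"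
    by (simp add: u_def v_def algebra_simps)
  then have "u * numer k + v * numer (Suc k) = m" unfolding d using \<delta> by (simp add: mult.commute mult.left_commute)
  ultimately show ?thesis by metis
qed

lemma err_Suc_Suc: "err (Suc (Suc k)) = err k - quot (Suc k) * err (Suc k)"
  by (simp add: err_def algebra_simps)

lemma offset_Suc: "offset (Suc k) = err (Suc k) - offset k"
  by (simp add: offset_def err_def denom_sum_def numer_sum_def algebra_simps)

abbreviation contraction :: real where "contraction \<equiv> sqrt 10 - 3"

text \<open>A block of three quotients scales the errors by sqrt 10 - 3, the absolute value of the
  small eigenvalue, so the three initial values determine all.\<close>

lemma err_closed_form:
  "err (3 * m) = contraction ^ m * slope \<and> err (Suc (3 * m)) = contraction ^ m * (1 - 2 * slope)
   \<and> err (Suc (Suc (3 * m))) = contraction ^ m * (3 * slope - 1)"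
proof (induction m)
  case 0
  show ?case by (simp add: err_def quot_def)
next
  case (Suc m)
  let ?p = "contraction ^ m"
  have e: "3 * Suc m = Suc (Suc (Suc (3 * m)))" by simp
  have s: "err (3 * m) = ?p * slope" "err (Suc (3 * m)) = ?p * (1 - 2 * slope)"
    "err (Suc (Suc (3 * m))) = ?p * (3 * slope - 1)" using Suc by auto
  have "err (3 * Suc m) = err (Suc (3 * m)) - err (Suc (Suc (3 * m)))"
    unfolding e err_Suc_Suc[of "Suc (3 * m)"] by simp
  then have 0: "err (3 * Suc m) = ?p * (2 - 5 * slope)"
    unfolding s by (simp add: algebra_simps)
  have "err (Suc (3 * Suc m)) = err (Suc (Suc (3 * m))) - 2 * err (3 * Suc m)"
    unfolding e err_Suc_Suc[of "Suc (Suc (3 * m))"] using quot_mod_3(1)[of "Suc m"] unfolding e by simp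
  then have 1: "err (Suc (3 * Suc m)) = ?p * (13 * slope - 5)"
    unfolding s 0 by (simp add: algebra_simps)
  have "err (Suc (Suc (3 * Suc m))) = err (3 * Suc m) - err (Suc (3 * Suc m))"
    unfolding err_Suc_Suc[of "3 * Suc m"] quot_mod_3(2) by simp
  then have 2: "err (Suc (Suc (3 * Suc m))) = ?p * (7 - 18 * slope)"
    unfolding 0 1 by (simp add: algebra_simps)
  have "2 - 5 * slope = contraction * slope" "13 * slope - 5 = contraction * (1 - 2 * slope)"
    "7 - 18 * slope = contraction * (3 * slope - 1)"
    by (simp_all add: slope_def field_simps)
  then show ?case unfolding 0 1 2 by simp
qed

text \<open>Three steps negate the offset and add a multiple of \<open>contraction ^ m\<close>; only
  one initial value is scaled by \<open>contraction\<close> under this rule, and the intercept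
  produces it.\<close>

lemma offset_closed_form: "offset (3 * m) = contraction ^ m * (2/3 * contraction)"
proof (induction m)
  case 0
  show ?case by (simp add: offset_def denom_sum_def numer_sum_def slope_def intercept_def field_simps)
next
  case (Suc m)
  let ?p = "contraction ^ m"
  have e: "3 * Suc m = Suc (Suc (Suc (3 * m)))" by simp
  have "offset (3 * Suc m) = err (3 * Suc m) - err (Suc (Suc (3 * m))) + err (Suc (3 * m)) - offset (3 * m)"
    unfolding e by (simp only: offset_Suc)
  also have "\<dots> = ?p * (contraction * slope - (3 * slope - 1) + (1 - 2 * slope) - 2/3 * contraction)"
    unfolding err_closed_form[of m, THEN conjunct2, THEN conjunct1]
      err_closed_form[of m, THEN conjunct2, THEN conjunct2] err_closed_form[of "Suc m", THEN conjunct1] Suc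
    by (simp add: algebra_simps)
  also have "contraction * slope - (3 * slope - 1) + (1 - 2 * slope) - 2/3 * contraction
      = contraction * (2/3 * contraction)"
    by (simp add: slope_def field_simps)
  finally show ?case by simp
qed

text \<open>A power of \<open>contraction\<close> factors out, leaving numerical inequalities for
  each residue of k modulo 3. The bound by \<open>err (Suc k)\<close> serves
  \<open>no_close_point\<close>; the bound by the difference serves the repetitions at 0.\<close>

lemma err_offset_bounds:
  "0 < err (Suc k)" "err (Suc k) < err k" "0 < offset (Suc k)" "offset (Suc k) < err (Suc k)"
  "offset (Suc k) < err k - err (Suc k)" "err k < 1"
proof -
  have c: "0 < contraction" "contraction < 1" using sqrt10_bounds by auto
  have "0 < err (Suc k) \<and> err (Suc k) < err k \<and> 0 < offset (Suc k) \<and> offset (Suc k) < err (Suc k)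
    \<and> offset (Suc k) < err k - err (Suc k) \<and> err k < 1"
  proof -
    define m where "m = k div 3"
    define p where "p = contraction ^ m"
    have p: "0 < p" "p \<le> 1" using c by (auto simp: p_def power_le_one)
    have E: "err (3 * m) = p * slope" "err (Suc (3 * m)) = p * (1 - 2 * slope)"
      "err (Suc (Suc (3 * m))) = p * (3 * slope - 1)" "err (Suc (Suc (Suc (3 * m)))) = p * (2 - 5 * slope)"
    proof -
      show s: "err (3 * m) = p * slope" "err (Suc (3 * m)) = p * (1 - 2 * slope)"
        "err (Suc (Suc (3 * m))) = p * (3 * slope - 1)"
        using err_closed_form[of m] by (simp_all add: p_def)
      have "err (Suc (Suc (Suc (3 * m)))) = err (Suc (3 * m)) - err (Suc (Suc (3 * m)))"
        unfolding err_Suc_Suc[of "Suc (3 * m)"] by simp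
      then show "err (Suc (Suc (Suc (3 * m)))) = p * (2 - 5 * slope)"
        unfolding s by (simp add: algebra_simps)
    qed
    have O0: "offset (3 * m) = p * (2/3 * contraction)" using offset_closed_form by (simp add: p_def)
    have O1: "offset (Suc (3 * m)) = p * (1 - 2 * slope - 2/3 * contraction)"
      unfolding offset_Suc E O0 by (simp add: algebra_simps)
    have O2: "offset (Suc (Suc (3 * m))) = p * (5 * slope - 2 + 2/3 * contraction)"
      unfolding offset_Suc E O0 by (simp add: algebra_simps)
    have O3: "offset (Suc (Suc (Suc (3 * m)))) = p * (4 - 10 * slope - 2/3 * contraction)"
      unfolding offset_Suc E O0 by (simp add: algebra_simps)
    have lt: "p * x < p * y" if "x < y" for x y :: real using that p by simp
    have lt0: "0 < p * y" if "0 < y" for y :: real using that p by simp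
    have "p * slope < 1 * 1" using p sqrt10_bounds by (intro mult_le_less_imp_less) (auto simp: slope_def)
    then have lt1: "p * slope < 1" by simp
    have S: "387/1000 < slope" "slope < 3875/10000" using sqrt10_bounds by (auto simp: slope_def)
    consider "k = 3 * m" | "k = Suc (3 * m)" | "k = Suc (Suc (3 * m))" unfolding m_def by linarith
    then show ?thesis
    proof cases
      case 1
      show ?thesis unfolding 1 E O1 right_diff_distrib[symmetric, of p]
        using sqrt10_bounds lt1 by (intro conjI lt lt0) (auto simp: slope_def field_simps)
    next
      case 2
      have "p * (1 - 2 * slope) < p * slope" using S by (intro lt) simp
      then show ?thesis unfolding 2 E O2 right_diff_distrib[symmetric, of p]
        using sqrt10_bounds lt1 by (intro conjI lt lt0) (auto simp: slope_def field_simps)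
    next
      case 3
      have "p * (3 * slope - 1) < p * slope" using S by (intro lt) simp
      then show ?thesis unfolding 3 E O3 right_diff_distrib[symmetric, of p]
        using sqrt10_bounds lt1 by (intro conjI lt lt0) (auto simp: slope_def field_simps)
    qed
  qed
  then show "0 < err (Suc k)" "err (Suc k) < err k" "0 < offset (Suc k)" "offset (Suc k) < err (Suc k)"
    "offset (Suc k) < err k - err (Suc k)" "err k < 1" by blast+
qed

text \<open>In the basis of two consecutive convergents, (-1)^k (n * slope - m) equals u * err k - v
  * err (Suc k). The lower bound forces u >= 1, since otherwise v <= 0 and n <= 0; the upper bounds
  then force v >= 1 and v >= 2 respectively.\<close>

lemma no_close_point:
  fixes n m :: int
  assumes n: "1 \<le> n" and lo: "0 \<le> offset (Suc k) + (-1) ^ k * (n * slope - m)"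
  shows "offset (Suc k) + (-1) ^ k * (n * slope - m) \<le> err k \<Longrightarrow> n < denom k + denom (Suc k) \<Longrightarrow> False"
    and "offset (Suc k) + (-1) ^ k * (n * slope - m) \<le> err k - err (Suc k) \<Longrightarrow> n < denom k + 2 * denom (Suc k) \<Longrightarrow> False"
proof -
  obtain u v :: int where uv: "n = u * int (denom k) + v * int (denom (Suc k))"
      "m = u * int (numer k) + v * int (numer (Suc k))"
    using lattice_decomposition by blast
  have eq: "(-1) ^ k * (n * slope - m) = u * err k - v * err (Suc k)"
    unfolding uv by (simp add: err_def algebra_simps)
  note bd = err_offset_bounds[of k]
  have u: "u \<ge> 1"
  proof (rule ccontr)
    assume "\<not> u \<ge> 1"
    then have u0: "u \<le> 0" by simp
    have "u * err k \<le> 0" using u0 bd by (simp add: mult_le_0_iff)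
    then have "v * err (Suc k) < 1 * err (Suc k)" using lo bd unfolding eq by linarith
    then have "real_of_int v < 1" using bd by (simp only: mult_less_cancel_right_pos)
    then have "v \<le> 0" by simp
    then have "n \<le> 0" unfolding uv using u0 by (simp add: add_nonpos_nonpos mult_nonpos_nonneg)
    then show False using n by simp
  qed
  have uk: "(real_of_int u - 1) * err k \<ge> 0" using u bd by simp
  have du: "u * int (denom k) \<ge> denom k" using mult_right_mono[OF u, of "int (denom k)"] by simp
  {
    assume a: "offset (Suc k) + (-1) ^ k * (n * slope - m) \<le> err k" "n < denom k + denom (Suc k)"
    have "0 < v * err (Suc k)" using a(1) uk bd unfolding eq left_diff_distrib by linarith
    then have "v \<ge> 1" using bd by (simp add: zero_less_mult_iff)
    then have "v * int (denom (Suc k)) \<ge> denom (Suc k)"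
      using mult_right_mono[of 1 v "int (denom (Suc k))"] by simp
    then show False using a(2) du unfolding uv by linarith
  next
    assume a: "offset (Suc k) + (-1) ^ k * (n * slope - m) \<le> err k - err (Suc k)" "n < denom k + 2 * denom (Suc k)"
    have "1 * err (Suc k) < v * err (Suc k)" using a(1) uk bd unfolding eq left_diff_distrib by linarith
    then have "1 < real_of_int v" using bd by (simp only: mult_less_cancel_right_pos)
    then have "v \<ge> 2" by simp
    then have "v * int (denom (Suc k)) \<ge> 2 * int (denom (Suc k))" by (intro mult_right_mono) auto
    then show False using a(2) du unfolding uv by linarith
  }
qed

section \<open>Floor differences and the exact location of repetitions\<close>

text \<open>The two floors differ exactly when an integer separates y from y + \<eta>. The sign
  \<sigma> treats both directions at once; a nonstrict necessary and a strict sufficient condition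
  avoid deciding the endpoints.\<close>

lemma floor_difference:
  fixes y \<eta> \<sigma> :: real
  assumes \<sigma>: "\<sigma> = 1 \<or> \<sigma> = -1" and \<eta>: "0 < \<sigma> * \<eta>" "\<sigma> * \<eta> < 1"
  defines "D \<equiv> real_of_int (\<lfloor>y + \<eta>\<rfloor> - \<lfloor>y\<rfloor>)"
  shows "\<sigma> * D = 0 \<or> \<sigma> * D = 1"
    and "\<sigma> * D = 1 \<Longrightarrow> \<exists>M. 0 \<le> \<sigma> * (real_of_int M - y) \<and> \<sigma> * (real_of_int M - y) \<le> \<sigma> * \<eta>"
    and "0 < \<sigma> * (real_of_int M - y) \<Longrightarrow> \<sigma> * (real_of_int M - y) < \<sigma> * \<eta> \<Longrightarrow> \<sigma> * D = 1"
proof -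
  have f: "real_of_int \<lfloor>y\<rfloor> \<le> y" "y < real_of_int \<lfloor>y\<rfloor> + 1"
    "real_of_int \<lfloor>y + \<eta>\<rfloor> \<le> y + \<eta>" "y + \<eta> < real_of_int \<lfloor>y + \<eta>\<rfloor> + 1" by linarith+
  from \<sigma> have "(\<sigma> * D = 0 \<or> \<sigma> * D = 1)
    \<and> (\<sigma> * D = 1 \<longrightarrow> (\<exists>M. 0 \<le> \<sigma> * (real_of_int M - y) \<and> \<sigma> * (real_of_int M - y) \<le> \<sigma> * \<eta>))
    \<and> (0 < \<sigma> * (real_of_int M - y) \<longrightarrow> \<sigma> * (real_of_int M - y) < \<sigma> * \<eta> \<longrightarrow> \<sigma> * D = 1)"
  proof
    assume s: "\<sigma> = 1"
    have A: "\<lfloor>y + \<eta>\<rfloor> = \<lfloor>y\<rfloor> \<or> \<lfloor>y + \<eta>\<rfloor> = \<lfloor>y\<rfloor> + 1" using f \<eta> unfolding s by linarith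
    show ?thesis
    proof (intro conjI impI)
      show "\<sigma> * D = 0 \<or> \<sigma> * D = 1" using A by (auto simp: s D_def)
    next
      assume "\<sigma> * D = 1"
      then have "real_of_int \<lfloor>y + \<eta>\<rfloor> - real_of_int \<lfloor>y\<rfloor> = 1" by (simp add: s D_def)
      then have "y \<le> real_of_int \<lfloor>y + \<eta>\<rfloor>" "real_of_int \<lfloor>y + \<eta>\<rfloor> - y \<le> \<eta>" using f by linarith+
      then show "\<exists>M. 0 \<le> \<sigma> * (real_of_int M - y) \<and> \<sigma> * (real_of_int M - y) \<le> \<sigma> * \<eta>"
        unfolding s by (intro exI[of _ "\<lfloor>y + \<eta>\<rfloor>"] conjI; simp only: mult_1_left mult_minus1; linarith)
    next
      assume "0 < \<sigma> * (real_of_int M - y)" "\<sigma> * (real_of_int M - y) < \<sigma> * \<eta>"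
      then have "y < real_of_int M" "real_of_int M - y < \<eta>" by (simp_all add: s)
      then have "real_of_int \<lfloor>y\<rfloor> < real_of_int M" "real_of_int M < real_of_int \<lfloor>y + \<eta>\<rfloor> + 1"
        using f by linarith+
      then have "\<lfloor>y\<rfloor> < M" "M < \<lfloor>y + \<eta>\<rfloor> + 1" by linarith+
      then have "\<lfloor>y + \<eta>\<rfloor> = \<lfloor>y\<rfloor> + 1" using A by linarith
      then show "\<sigma> * D = 1" by (simp add: s D_def)
    qed
  next
    assume s: "\<sigma> = -1"
    have A: "\<lfloor>y + \<eta>\<rfloor> = \<lfloor>y\<rfloor> \<or> \<lfloor>y + \<eta>\<rfloor> = \<lfloor>y\<rfloor> - 1" using f \<eta> unfolding s by linarith
    show ?thesis
    proof (intro conjI impI)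
      show "\<sigma> * D = 0 \<or> \<sigma> * D = 1" using A by (auto simp: s D_def)
    next
      assume "\<sigma> * D = 1"
      then have "real_of_int \<lfloor>y\<rfloor> - real_of_int \<lfloor>y + \<eta>\<rfloor> = 1" by (simp add: s D_def)
      then have "real_of_int \<lfloor>y\<rfloor> \<le> y" "\<eta> \<le> real_of_int \<lfloor>y\<rfloor> - y" using f by linarith+
      then show "\<exists>M. 0 \<le> \<sigma> * (real_of_int M - y) \<and> \<sigma> * (real_of_int M - y) \<le> \<sigma> * \<eta>"
        unfolding s by (intro exI[of _ "\<lfloor>y\<rfloor>"] conjI; simp only: mult_1_left mult_minus1; linarith)
    next
      assume "0 < \<sigma> * (real_of_int M - y)" "\<sigma> * (real_of_int M - y) < \<sigma> * \<eta>"
      then have "real_of_int M < y" "\<eta> < real_of_int M - y" by (simp_all add: s)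
      then have "real_of_int \<lfloor>y + \<eta>\<rfloor> < real_of_int M" "real_of_int M < real_of_int \<lfloor>y\<rfloor> + 1"
        using f by linarith+
      then have "\<lfloor>y + \<eta>\<rfloor> < M" "M < \<lfloor>y\<rfloor> + 1" by linarith+
      then have "\<lfloor>y + \<eta>\<rfloor> = \<lfloor>y\<rfloor> - 1" using A by linarith
      then show "\<sigma> * D = 1" by (simp add: s D_def)
    qed
  qed
  then show "\<sigma> * D = 0 \<or> \<sigma> * D = 1"
    "\<sigma> * D = 1 \<Longrightarrow> \<exists>M. 0 \<le> \<sigma> * (real_of_int M - y) \<and> \<sigma> * (real_of_int M - y) \<le> \<sigma> * \<eta>"
    "0 < \<sigma> * (real_of_int M - y) \<Longrightarrow> \<sigma> * (real_of_int M - y) < \<sigma> * \<eta> \<Longrightarrow> \<sigma> * D = 1" by blast+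
qed

definition mech :: "nat \<Rightarrow> int" where "mech n = \<lfloor>real n * slope + intercept\<rfloor>"

text \<open>Letters of the word are increments of \<open>mech\<close>, so the factors at i and j
  agree as long as this quantity is constant; P is the expected increment over j - i steps.\<close>

definition deviation :: "nat \<Rightarrow> nat \<Rightarrow> nat \<Rightarrow> nat \<Rightarrow> real" where
  "deviation i j P x = real_of_int (mech (x + j) - mech (x + i) - int P)"

text \<open>The common sign prevents cancellation in the error series. Vanishing is asked only from
  x = 1 on because the word starts with letter 1.\<close>

definition first_deviation :: "nat \<Rightarrow> nat \<Rightarrow> nat \<Rightarrow> nat \<Rightarrow> bool" where
  "first_deviation i j P X \<longleftrightarrow> (\<exists>\<sigma>. (\<sigma> = 1 \<or> \<sigma> = -1)
     \<and> (\<forall>x. \<sigma> * deviation i j P x = 0 \<or> \<sigma> * deviation i j P x = 1)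
     \<and> \<sigma> * deviation i j P X = 1 \<and> (\<forall>x. 1 \<le> x \<longrightarrow> x < X \<longrightarrow> deviation i j P x = 0))"

text \<open>At position \<open>denom_sum (Suc k)\<close> the signed distance to a certain integer is
  exactly \<open>offset (Suc k)\<close>, which lies in the window (0, U), so a deviation occurs
  there. An earlier deviation at x would give a close point with n = X - x.\<close>

lemma first_deviationI:
  assumes U: "(-1) ^ k * ((real j - real i) * slope - real P) = U" "U < 1" "offset (Suc k) < U"
    and X: "i + X = denom_sum (Suc k)"
    and none: "\<And>n m :: int. 1 \<le> n \<Longrightarrow> n < int X \<Longrightarrow> 0 \<le> offset (Suc k) + (-1) ^ k * (n * slope - m)
       \<Longrightarrow> offset (Suc k) + (-1) ^ k * (n * slope - m) \<le> U \<Longrightarrow> False"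
  shows "first_deviation i j P X"
proof -
  define \<sigma> :: real where "\<sigma> = (-1) ^ k"
  define \<eta> where "\<eta> = (real j - real i) * slope - real P"
  define y where "y x = real (x + i) * slope + intercept" for x
  have \<sigma>: "\<sigma> = 1 \<or> \<sigma> = -1" unfolding \<sigma>_def by (cases "even k") auto
  have U': "\<sigma> * \<eta> = U" using U(1) by (simp add: \<sigma>_def \<eta>_def)
  have off: "0 < offset (Suc k)" using err_offset_bounds by blast
  have \<eta>: "0 < \<sigma> * \<eta>" "\<sigma> * \<eta> < 1" using U' U off by auto
  have dev: "deviation i j P x = real_of_int (\<lfloor>y x + \<eta>\<rfloor> - \<lfloor>y x\<rfloor>)" for x
  proof -
    have "real (x + j) * slope + intercept = (y x + \<eta>) + of_int (int P)"
      by (simp add: y_def \<eta>_def algebra_simps)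
    then have "mech (x + j) = \<lfloor>y x + \<eta>\<rfloor> + int P" unfolding mech_def by (simp only: floor_add_int)
    then show ?thesis by (simp add: deviation_def mech_def y_def)
  qed
  have fd: "\<sigma> * deviation i j P x = 0 \<or> \<sigma> * deviation i j P x = 1"
    "\<sigma> * deviation i j P x = 1 \<Longrightarrow> \<exists>M. 0 \<le> \<sigma> * (real_of_int M - y x) \<and> \<sigma> * (real_of_int M - y x) \<le> \<sigma> * \<eta>"
    "0 < \<sigma> * (real_of_int M - y x) \<Longrightarrow> \<sigma> * (real_of_int M - y x) < \<sigma> * \<eta> \<Longrightarrow> \<sigma> * deviation i j P x = 1"
    for x M
    unfolding dev using floor_difference[OF \<sigma> \<eta>] by blast+
  define M where "M = int (numer_sum (Suc k)) + 1"
  have yX: "\<sigma> * (real_of_int M - y X) = offset (Suc k)"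
  proof -
    have "X + i = denom_sum (Suc k)" using X by simp
    then show ?thesis unfolding y_def offset_def \<sigma>_def M_def by (simp add: algebra_simps)
  qed
  have at: "\<sigma> * deviation i j P X = 1"
    using fd(3)[of M X] yX off U(3) U' by simp
  have before: "deviation i j P x = 0" if x: "1 \<le> x" "x < X" for x
  proof (rule ccontr)
    assume "deviation i j P x \<noteq> 0"
    then have "\<sigma> * deviation i j P x = 1" using fd(1)[of x] \<sigma> by auto
    then obtain M' :: int where M': "0 \<le> \<sigma> * (M' - y x)" "\<sigma> * (M' - y x) \<le> U" using fd(2)[of x] U' by blast
    define n where "n = int X - int x"
    have "\<sigma> * (n * slope - (M - M')) = \<sigma> * (M' - y x) - \<sigma> * (M - y X)"
      using x by (simp add: n_def y_def of_nat_diff algebra_simps)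
    then have "offset (Suc k) + (-1) ^ k * (n * slope - (M - M')) = \<sigma> * (M' - y x)"
      using yX by (simp add: \<sigma>_def)
    then show False using none[of n "M - M'"] M' x by (simp add: n_def)
  qed
  show ?thesis unfolding first_deviation_def using \<sigma> fd(1) at before by blast
qed

text \<open>Two consecutive convergents err on opposite sides, so the window is the difference of
  their errors.\<close>

lemma first_deviation_prefix:
  "first_deviation 0 (denom k + denom (Suc k)) (numer k + numer (Suc k)) (denom_sum (Suc k))"
proof (rule first_deviationI[where k = k and U = "err k - err (Suc k)"])
  note bd = err_offset_bounds[of k]
  show "(-1) ^ k * ((real (denom k + denom (Suc k)) - real 0) * slope - real (numer k + numer (Suc k)))
      = err k - err (Suc k)"
    by (simp add: err_def algebra_simps del: denom.simps numer.simps)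
  show "err k - err (Suc k) < 1" "offset (Suc k) < err k - err (Suc k)" using bd by auto
  have "denom_sum k \<le> denom k + denom (Suc k)"
  proof (cases k)
    case (Suc j)
    show ?thesis using denom_sum_less[of j] denom_sum_Suc[of j] unfolding Suc by linarith
  qed (simp add: denom_sum_def)
  then have le: "denom_sum (Suc k) \<le> denom k + 2 * denom (Suc k)"
    using denom_sum_Suc[of k] by linarith
  fix n m :: int
  assume n: "1 \<le> n" "n < int (denom_sum (Suc k))" "0 \<le> offset (Suc k) + (-1) ^ k * (n * slope - m)"
    "offset (Suc k) + (-1) ^ k * (n * slope - m) \<le> err k - err (Suc k)"
  show False using no_close_point(2)[OF n(1,3,4)] n(2) le by linarith
qed simp

text \<open>The two positions differ by a single denominator, so the window is a single
  error.\<close>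

lemma first_deviation_interior:
  "first_deviation (denom_sum k) (denom_sum (Suc k)) (numer (Suc k)) (denom (Suc k) + denom (Suc (Suc k)))"
proof (rule first_deviationI[where k = "Suc k" and U = "err (Suc k)"])
  note bd = err_offset_bounds[of "Suc k"]
  show "(-1) ^ Suc k * ((real (denom_sum (Suc k)) - real (denom_sum k)) * slope - real (numer (Suc k))) = err (Suc k)"
    by (simp add: err_def denom_sum_Suc del: denom.simps numer.simps)
  show "err (Suc k) < 1" "offset (Suc (Suc k)) < err (Suc k)" using bd by auto
  show "denom_sum k + (denom (Suc k) + denom (Suc (Suc k))) = denom_sum (Suc (Suc k))"
    by (simp only: denom_sum_Suc)
  fix n m :: int
  assume n: "1 \<le> n" "n < int (denom (Suc k) + denom (Suc (Suc k)))"
    "0 \<le> offset (Suc (Suc k)) + (-1) ^ Suc k * (n * slope - m)"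
    "offset (Suc (Suc k)) + (-1) ^ Suc k * (n * slope - m) \<le> err (Suc k)"
  show False using no_close_point(1)[OF n(1,3,4)] n(2) by simp
qed

section \<open>Growth of the denominators and of their sums\<close>

declare denom.simps(3) [simp del] numer.simps(3) [simp del]

lemma denom_block:
  fixes m :: nat
  defines "k \<equiv> 3 * m"
  shows "denom (k + 4) = 2 * denom (k + 3) + denom (k + 2)"
    "denom (k + 5) = 3 * denom (k + 3) + denom (k + 2)"
    "denom (k + 6) = 5 * denom (k + 3) + 2 * denom (k + 2)"
proof -
  have q: "quot (k + 3) = 2" "quot (k + 4) = 1" "quot (k + 5) = 1"
    by (simp_all add: quot_def k_def)
  show 4: "denom (k + 4) = 2 * denom (k + 3) + denom (k + 2)"
    using q(1) denom.simps(3)[of "k + 2"] by (simp add: numeral_eq_Suc)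
  show 5: "denom (k + 5) = 3 * denom (k + 3) + denom (k + 2)"
    using q(2) 4 denom.simps(3)[of "k + 3"] by (simp add: numeral_eq_Suc)
  show "denom (k + 6) = 5 * denom (k + 3) + 2 * denom (k + 2)"
    using q(3) 4 5 denom.simps(3)[of "k + 4"] by (simp add: numeral_eq_Suc)
qed


lemma denom_small: "denom (Suc (Suc 0)) = 3" "denom 3 = 5" "denom_sum 3 = 11"
proof -
  have q: "quot (Suc 0) = 1" "quot (Suc (Suc 0)) = 1" by (simp_all add: quot_def)
  show d2: "denom (Suc (Suc 0)) = 3" by (simp add: denom.simps(3) q)
  have d3: "denom (Suc (Suc (Suc 0))) = 5" by (simp add: denom.simps(3)[of "Suc 0"] q d2)
  have "denom_sum (Suc (Suc (Suc 0))) = denom_sum 0 + 2 + 3 + 5" by (simp only: denom_sum_Suc d2 d3 denom.simps(2))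
  then have ds: "denom_sum (Suc (Suc (Suc 0))) = 11" by (simp add: denom_sum_def)
  show "denom 3 = 5" using d3 unfolding numeral_3_eq_3[symmetric] .
  show "denom_sum 3 = 11" using ds unfolding numeral_3_eq_3[symmetric] .
qed

text \<open>The error-free form, multiplied by 3, of the invariant s - 2 b - 2/3 a; its value -1 is
  read off at m = 0.\<close>

lemma denom_sum_block: "3 * denom_sum (3 * m + 3) + 3 = 6 * denom (3 * m + 3) + 2 * denom (3 * m + 2)"
proof (induction m)
  case 0
  show ?case using denom_small by simp
next
  case (Suc m)
  have "denom_sum (3 * m + 6) = denom_sum (3 * m + 3) + denom (3 * m + 4) + denom (3 * m + 5) + denom (3 * m + 6)"
    using denom_sum_Suc[of "3 * m + 5"] denom_sum_Suc[of "3 * m + 4"] denom_sum_Suc[of "3 * m + 3"]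
    by (simp add: numeral_eq_Suc)
  then have "3 * denom_sum (3 * m + 6) + 3 = 6 * denom (3 * m + 6) + 2 * denom (3 * m + 5)"
    using Suc denom_block[of m] by linarith
  moreover have e: "3 * Suc m + 3 = 3 * m + 6" "3 * Suc m + 2 = 3 * m + 5" by simp_all
  ultimately show ?case unfolding e by blast
qed

text \<open>Each block multiplies the difference by exactly 3 - sqrt 10, so its absolute value only
  decreases.\<close>

lemma denom_ratio:
  "\<bar>real (denom (3 * m + 3)) - (2 + sqrt 10) / 3 * real (denom (3 * m + 2))\<bar> \<le> 1"
proof (induction m)
  case 0
  show ?case using denom_small sqrt10_bounds by simp
next
  case (Suc m)
  define \<kappa> where "\<kappa> = (2 + sqrt 10) / 3"
  define a where "a = real (denom (3 * m + 2))"
  define d where "d = real (denom (3 * m + 3))"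
  have \<kappa>: "3 * (\<kappa> * \<kappa>) = 4 * \<kappa> + 2" by (simp add: \<kappa>_def field_simps)
  have r: "sqrt 10 = 3 * \<kappa> - 2" by (simp add: \<kappa>_def field_simps)
  have e: "3 * Suc m + 3 = 3 * m + 6" "3 * Suc m + 2 = 3 * m + 5" by simp_all
  have n: "real (denom (3 * Suc m + 3)) = 5 * d + 2 * a" "real (denom (3 * Suc m + 2)) = 3 * d + a"
    using denom_block(2,3)[of m] unfolding e a_def d_def by simp_all
  have "real (denom (3 * Suc m + 3)) - \<kappa> * real (denom (3 * Suc m + 2)) = (3 - sqrt 10) * (d - \<kappa> * a)"
  proof -
    have "(5 * d + 2 * a) - \<kappa> * (3 * d + a) = (3 - (3 * \<kappa> - 2)) * (d - \<kappa> * a) + a * (4 * \<kappa> + 2 - 3 * (\<kappa> * \<kappa>))"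
      by (simp add: algebra_simps)
    then show ?thesis unfolding n r \<kappa> by simp
  qed
  then have "\<bar>real (denom (3 * Suc m + 3)) - \<kappa> * real (denom (3 * Suc m + 2))\<bar> = (sqrt 10 - 3) * \<bar>d - \<kappa> * a\<bar>"
    using sqrt10_bounds by (simp add: abs_mult)
  also have "\<dots> \<le> 1 * 1"
    using Suc sqrt10_bounds unfolding a_def d_def \<kappa>_def by (intro mult_mono) auto
  finally show ?case by (simp add: \<kappa>_def)
qed

abbreviation growth :: real where "growth \<equiv> 2/3 + 4 * sqrt 10 / 15"

lemma denom_sum_ratio_sharp:
  "\<bar>real (denom_sum (3 * m + 3)) - growth * real (denom (3 * m + 2) + denom (3 * m + 3))\<bar> \<le> 3"
proof -
  let ?\<kappa> = "(2 + sqrt 10) / 3"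
  define a where "a = real (denom (3 * m + 2))"
  define d where "d = real (denom (3 * m + 3))"
  define S where "S = real (denom_sum (3 * m + 3))"
  have "3 * S + 3 = 6 * d + 2 * a"
    using arg_cong[OF denom_sum_block[of m], of real] by (simp add: S_def d_def a_def)
  then have S: "S = 2 * d + 2/3 * a - 1" by simp
  have "S - growth * (a + d) = (2 - growth) * (d - ?\<kappa> * a) - 1" unfolding S by (simp add: field_simps)
  moreover have "\<bar>(2 - growth) * (d - ?\<kappa> * a)\<bar> \<le> 1 * 1"
    unfolding abs_mult using denom_ratio[of m] sqrt10_bounds by (intro mult_mono) (auto simp: a_def d_def)
  ultimately have "\<bar>S - growth * (a + d)\<bar> \<le> 3" by linarith
  then show ?thesis by (simp add: S_def a_def d_def)
qed

text \<open>Only the second bound at k = 2 modulo 3 is tight; elsewhere the smaller ratio 3/2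
  suffices, because the denominators a and d at the start of the block satisfy a <= d.\<close>

lemma growth_ratio:
  assumes "k \<ge> 3"
  shows "real (denom k + denom (Suc k)) \<le> growth * real (denom_sum k) + 3"
    and "real (denom_sum (Suc k)) \<le> growth * real (denom k + denom (Suc k)) + 3"
proof -
  have g: "growth * x \<ge> 3/2 * x" if "x \<ge> 0" for x :: real
    using sqrt10_bounds that by (intro mult_right_mono) auto
  define m where "m = (k - 3) div 3"
  define a where "a = real (denom (3 * m + 2))"
  define d where "d = real (denom (3 * m + 3))"
  have pos: "a \<ge> 0" "d \<ge> 0" by (simp_all add: a_def d_def)
  have "denom (3 * m + 2) \<le> denom (3 * m + 3)"
    using denom.simps(3)[of "3 * m + 1"] quot_ge_1[of "3 * m + 2"] by (simp add: numeral_eq_Suc trans_le_add1)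
  then have ad: "a \<le> d" by (simp add: a_def d_def)
  have S3: "real (denom_sum (3 * m + 3)) = 2 * d + 2/3 * a - 1"
    using arg_cong[OF denom_sum_block[of m], of real] by (simp add: d_def a_def)
  have D: "real (denom (3 * m + 3)) = d" "real (denom (3 * m + 4)) = 2 * d + a"
    "real (denom (3 * m + 5)) = 3 * d + a" "real (denom (3 * m + 6)) = 5 * d + 2 * a"
    unfolding denom_block by (simp_all add: a_def d_def)
  have S4: "real (denom_sum (3 * m + 4)) = 4 * d + 5/3 * a - 1"
    using denom_sum_Suc[of "3 * m + 3"] S3 D by (simp add: numeral_eq_Suc)
  have S5: "real (denom_sum (3 * m + 5)) = 7 * d + 8/3 * a - 1"
    using denom_sum_Suc[of "3 * m + 4"] S4 D by (simp add: numeral_eq_Suc)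
  have S6: "real (denom_sum (3 * m + 6)) \<le> growth * (real (denom (3 * m + 5)) + real (denom (3 * m + 6))) + 3"
    using denom_sum_ratio_sharp[of "Suc m"] by (simp add: abs_le_iff numeral_eq_Suc)
  have gs: "3/2 * real (denom_sum k) + 3 \<le> growth * real (denom_sum k) + 3"
    "3/2 * (real (denom k) + real (denom (Suc k))) + 3 \<le> growth * (real (denom k) + real (denom (Suc k))) + 3"
    by (intro add_right_mono g; simp)+
  have "k = 3 * m + 3 \<or> k = 3 * m + 4 \<or> k = 3 * m + 5" using assms unfolding m_def by linarith
  then have "real (denom k) + real (denom (Suc k)) \<le> 3/2 * real (denom_sum k) + 3
    \<and> (real (denom_sum (Suc k)) \<le> 3/2 * (real (denom k) + real (denom (Suc k))) + 3
      \<or> real (denom_sum (Suc k)) \<le> growth * (real (denom k) + real (denom (Suc k))) + 3)"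
  proof (elim disjE)
    assume k: "k = 3 * m + 3"
    then have e: "Suc k = 3 * m + 4" by simp
    have "d + (2 * d + a) \<le> 3/2 * (2 * d + 2/3 * a - 1) + 3" "4 * d + 5/3 * a - 1 \<le> 3/2 * (d + (2 * d + a)) + 3"
      using pos ad by (simp_all add: field_simps)
    then show ?thesis unfolding e unfolding k D S3 S4 by blast
  next
    assume k: "k = 3 * m + 4"
    then have e: "Suc k = 3 * m + 5" by simp
    have "2 * d + a + (3 * d + a) \<le> 3/2 * (4 * d + 5/3 * a - 1) + 3"
      "7 * d + 8/3 * a - 1 \<le> 3/2 * (2 * d + a + (3 * d + a)) + 3" using pos ad by (simp_all add: field_simps)
    then show ?thesis unfolding e unfolding k D S4 S5 by blast
  next
    assume k: "k = 3 * m + 5"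
    then have e: "Suc k = 3 * m + 6" by simp
    have "3 * d + a + (5 * d + 2 * a) \<le> 3/2 * (7 * d + 8/3 * a - 1) + 3" using pos ad by (simp add: field_simps)
    then show ?thesis using S6 unfolding e unfolding k D S5 by blast
  qed
  then have "real (denom k) + real (denom (Suc k)) \<le> growth * real (denom_sum k) + 3"
    "real (denom_sum (Suc k)) \<le> growth * (real (denom k) + real (denom (Suc k))) + 3"
    using gs order_trans by blast+
  then show "real (denom k + denom (Suc k)) \<le> growth * real (denom_sum k) + 3"
    "real (denom_sum (Suc k)) \<le> growth * real (denom k + denom (Suc k)) + 3" by simp_all
qed


lemma denom_ge: "denom k \<ge> k + 1"
proof (induction k rule: denom.induct)
  case (3 k)
  have "denom (Suc k) \<le> quot (Suc k) * denom (Suc k)" by (metis mult_1 mult_le_mono1 quot_ge_1)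
  then show ?case using 3 unfolding denom.simps(3) by linarith
qed auto

lemma denom_sum_ge: "denom_sum (Suc k) \<ge> 2 * k + 3"
proof -
  have "denom k \<le> denom_sum k" unfolding denom_sum_def by (intro member_le_sum) auto
  then show ?thesis using denom_ge[of k] denom_ge[of "Suc k"] denom_sum_Suc[of k] by linarith
qed

text \<open>The first nonzero term bounds the sum from below, a geometric series from above. The
  factor b - 1 is the one that summation by parts will put in front of the sum.\<close>

lemma binary_series_bounds:
  fixes h :: "nat \<Rightarrow> real" and b :: nat
  assumes b: "b \<ge> 2" and h: "\<And>x. h x = 0 \<or> h x = 1" and X: "\<And>x. x < X \<Longrightarrow> h x = 0" "h X = 1"
  shows "summable (\<lambda>x. h x / real b ^ Suc x)"
    and "1 / real b ^ Suc X \<le> (\<Sum>x. h x / real b ^ Suc x)"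
    and "(real b - 1) * (\<Sum>x. h x / real b ^ Suc x) \<le> 1 / real b ^ X"
proof -
  have b1: "real b > 1" using b by simp
  have geo: "summable (\<lambda>x. (1 / real b) ^ x)" using b1 by (intro summable_geometric) auto
  have h01: "0 \<le> h x" "h x \<le> 1" for x using h[of x] by auto
  have bound: "h x / real b ^ Suc x \<le> (1 / real b) ^ Suc x" for x
    using h01[of x] b1 by (simp add: power_one_over divide_right_mono)
  show sm: "summable (\<lambda>x. h x / real b ^ Suc x)"
  proof (rule summable_comparison_test)
    show "\<exists>N. \<forall>n\<ge>N. norm (h n / real b ^ Suc n) \<le> (1 / real b) ^ Suc n" using bound h01 by simp
    show "summable (\<lambda>n. (1 / real b) ^ Suc n)" using geo by (subst summable_Suc_iff)
  qed
  have "sum (\<lambda>x. h x / real b ^ Suc x) {X} \<le> (\<Sum>x. h x / real b ^ Suc x)"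
    using sm h01 by (intro sum_le_suminf) auto
  then show "1 / real b ^ Suc X \<le> (\<Sum>x. h x / real b ^ Suc x)" using X(2) by simp
  have "(\<Sum>x. h x / real b ^ Suc x) = (\<Sum>x. h (x + X) / real b ^ Suc (x + X)) + (\<Sum>x<X. h x / real b ^ Suc x)"
    by (rule suminf_split_initial_segment[OF sm])
  also have "(\<Sum>x<X. h x / real b ^ Suc x) = 0" using X(1) by simp
  finally have "(\<Sum>x. h x / real b ^ Suc x) = (\<Sum>x. h (x + X) / real b ^ Suc (x + X))" by simp
  also have "\<dots> \<le> (\<Sum>x. (1 / real b) ^ Suc X * (1 / real b) ^ x)"
  proof (rule suminf_le)
    show "h (x + X) / real b ^ Suc (x + X) \<le> (1 / real b) ^ Suc X * (1 / real b) ^ x" for x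
      using bound[of "x + X"] by (simp add: power_add ac_simps)
    show "summable (\<lambda>x. h (x + X) / real b ^ Suc (x + X))" using sm by (rule summable_ignore_initial_segment)
    show "summable (\<lambda>x. (1 / real b) ^ Suc X * (1 / real b) ^ x)" using geo by (rule summable_mult)
  qed
  also have "\<dots> = (1 / real b) ^ Suc X * (1 / (1 - 1 / real b))"
    using b1 by (subst suminf_mult[OF geo]) (simp add: suminf_geometric)
  also have "\<dots> = (1 / real b ^ X) / (real b - 1)" using b1 by (simp add: power_one_over field_simps)
  finally have "(real b - 1) * (\<Sum>x. h x / real b ^ Suc x) \<le> (real b - 1) * ((1 / real b ^ X) / (real b - 1))"
    using b1 by (intro mult_left_mono) auto
  also have "\<dots> = 1 / real b ^ X" using b1 by simp
  finally show "(real b - 1) * (\<Sum>x. h x / real b ^ Suc x) \<le> 1 / real b ^ X" .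
qed

definition extremal_word :: "nat \<Rightarrow> nat" where "extremal_word n = nat (mech (Suc n) - mech n)"

lemma extremal_word_real: "real (extremal_word n) = real_of_int (mech (Suc n) - mech n)"
  and extremal_word_less: "extremal_word n < 2"
proof -
  have m: "mech (Suc n) = \<lfloor>(real n * slope + intercept) + slope\<rfloor>" by (simp add: mech_def algebra_simps)
  have "0 < 1 * slope" "1 * slope < 1" using sqrt10_bounds by (auto simp: slope_def)
  then have "1 * real_of_int (mech (Suc n) - mech n) = 0 \<or> 1 * real_of_int (mech (Suc n) - mech n) = 1"
    unfolding m mech_def[of n] by (intro floor_difference) auto
  then have "mech (Suc n) - mech n = 0 \<or> mech (Suc n) - mech n = 1"
    unfolding mult_1 of_int_eq_0_iff of_int_eq_1_iff .
  then show "real (extremal_word n) = real_of_int (mech (Suc n) - mech n)" "extremal_word n < 2"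
    by (auto simp: extremal_word_def)
qed

lemma extremal_word_over: "b \<ge> 2 \<Longrightarrow> word_over b extremal_word"
  unfolding word_over_def using extremal_word_less by (meson order.strict_trans2)

text \<open>Summation by parts expresses the approximation error through the deviations, which all have the
  same sign; therefore the first nonzero one determines its size.\<close>

lemma extremal_approximant:
  assumes b: "b \<ge> 2" and ij: "i < j" and X: "X \<ge> 1" and fd: "first_deviation i j P X"
  shows "\<exists>Q R :: int. 1 \<le> Q \<and> Q \<le> int b ^ j \<and> 1 / real b ^ X \<le> \<bar>Q * word_value b extremal_word - R\<bar>
    \<and> \<bar>Q * word_value b extremal_word - R\<bar> \<le> b / real b ^ X"
proof -
  interpret digit_word b extremal_word using b extremal_word_over by unfold_locales auto
  have b1: "real b > 1" using b by simp
  let ?\<xi> = "word_value b extremal_word"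
  obtain \<sigma> where \<sigma>: "\<sigma> = 1 \<or> \<sigma> = -1" "\<And>x. \<sigma> * deviation i j P x = 0 \<or> \<sigma> * deviation i j P x = 1"
      "\<sigma> * deviation i j P X = 1" "\<And>x. 1 \<le> x \<Longrightarrow> x < X \<Longrightarrow> deviation i j P x = 0"
    using fd unfolding first_deviation_def by blast
  define h where "h x = \<sigma> * deviation i j P (Suc x)" for x
  define H where "H = (\<Sum>x. h x / real b ^ Suc x)"
  have X': "Suc (X - 1) = X" using X by simp
  have hX: "h x = 0 \<or> h x = 1" "x < X - 1 \<Longrightarrow> h x = 0" "h (X - 1) = 1" for x
    using \<sigma> X' by (auto simp: h_def)
  note hb = binary_series_bounds[where h = h and b = b and X = "X - 1", OF b hX, folded H_def]
  have sq: "\<sigma> * \<sigma> = 1" using \<sigma>(1) by auto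
  have "\<sigma> * (tail j - tail i) = (real b - 1) * H - h 0"
  proof -
    have s1: "summable (\<lambda>x. h (Suc x) / real b ^ Suc (Suc x))"
      using hb(1) by (subst summable_Suc_iff[of "\<lambda>x. h x / real b ^ Suc x"])
    have "tail j - tail i = (\<Sum>x. real (extremal_word (Suc (j + x))) / real b ^ Suc x
        - real (extremal_word (Suc (i + x))) / real b ^ Suc x)"
      unfolding tail_def by (rule suminf_diff[OF tail_summable tail_summable])
    also have "\<dots> = (\<Sum>x. \<sigma> * (real b * (h (Suc x) / real b ^ Suc (Suc x)) - h x / real b ^ Suc x))"
    proof (rule suminf_cong)
      fix x
      have "real (extremal_word (Suc (j + x))) - real (extremal_word (Suc (i + x)))
          = deviation i j P (Suc (Suc x)) - deviation i j P (Suc x)"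
        unfolding extremal_word_real deviation_def by (simp add: add.commute)
      also have "\<dots> = \<sigma> * (h (Suc x) - h x)"
        using sq by (simp add: h_def right_diff_distrib mult.assoc[symmetric])
      finally show "real (extremal_word (Suc (j + x))) / real b ^ Suc x - real (extremal_word (Suc (i + x))) / real b ^ Suc x
        = \<sigma> * (real b * (h (Suc x) / real b ^ Suc (Suc x)) - h x / real b ^ Suc x)"
        using b1 by (simp add: diff_divide_distrib[symmetric])
    qed
    also have "\<dots> = \<sigma> * (\<Sum>x. real b * (h (Suc x) / real b ^ Suc (Suc x)) - h x / real b ^ Suc x)"
      by (intro suminf_mult summable_diff summable_mult s1 hb(1))
    also have "(\<Sum>x. real b * (h (Suc x) / real b ^ Suc (Suc x)) - h x / real b ^ Suc x)
        = (\<Sum>x. real b * (h (Suc x) / real b ^ Suc (Suc x))) - H"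
      unfolding H_def by (rule suminf_diff[symmetric, OF summable_mult[OF s1] hb(1)])
    also have "(\<Sum>x. real b * (h (Suc x) / real b ^ Suc (Suc x))) = real b * (\<Sum>x. h (Suc x) / real b ^ Suc (Suc x))"
      by (rule suminf_mult[OF s1])
    also have "(\<Sum>x. h (Suc x) / real b ^ Suc (Suc x)) = H - h 0 / real b"
      unfolding H_def using suminf_split_head[OF hb(1)] by simp
    finally have "tail j - tail i = \<sigma> * ((real b - 1) * H - h 0)" using b1 by (simp add: algebra_simps)
    then show ?thesis using sq by (simp add: mult.assoc[symmetric])
  qed
  then have "tail j - tail i = \<sigma> * ((real b - 1) * H) - \<sigma> * h 0"
    using sq by (metis (no_types, opaque_lifting) mult.assoc mult_1 right_diff_distrib)
  moreover have "\<sigma> * h 0 = deviation i j P 1" using sq by (simp add: h_def mult.assoc[symmetric])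
  ultimately have tails: "tail j - tail i = \<sigma> * ((real b - 1) * H) - deviation i j P 1" by simp
  obtain Pi Pj :: int where P: "real b ^ i * ?\<xi> - tail i = Pi" "real b ^ j * ?\<xi> - tail j = Pj"
    using tail_eq_mod_Ints by metis
  define Q where "Q = int b ^ j - int b ^ i"
  \<comment> \<open>The boundary term \<open>deviation i j P 1\<close> of the summation by parts is
    an integer and is absorbed here, leaving only the series of constant sign.\<close>
  define R where "R = Pj - Pi - (mech (1 + j) - mech (1 + i) - int P)"
  have Qr: "real_of_int Q = real b ^ j - real b ^ i" by (simp add: Q_def)
  have "real b ^ i < real b ^ j" using b1 ij by (intro power_strict_increasing) auto
  then have "real_of_int Q > 0" unfolding Qr by simp
  then have Q1: "1 \<le> Q" by simp
  have Q2: "Q \<le> int b ^ j" by (simp add: Q_def)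
  have "Q * ?\<xi> - R = \<sigma> * ((real b - 1) * H)"
    unfolding Qr using P tails by (simp add: R_def deviation_def algebra_simps)
  then have abs: "\<bar>Q * ?\<xi> - R\<bar> = (real b - 1) * \<bar>H\<bar>" using \<sigma>(1) b1 by (auto simp: abs_mult)
  have lo: "1 / real b ^ X \<le> H" using hb(2) unfolding X' .
  have "1 / real b ^ X > 0" using b1 by simp
  then have H0: "H > 0" using lo by linarith
  have "H \<le> (real b - 1) * H" using mult_right_mono[of 1 "real b - 1" H] H0 b by simp
  then have 1: "1 / real b ^ X \<le> \<bar>Q * ?\<xi> - R\<bar>"
    unfolding abs abs_of_pos[OF H0] using lo by (rule order_trans[rotated])
  have "real b ^ X = real b * real b ^ (X - 1)" using power_Suc[of "real b" "X - 1"] unfolding X' .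
  then have "1 / real b ^ (X - 1) = b / real b ^ X" using b1 by simp
  then have 2: "\<bar>Q * ?\<xi> - R\<bar> \<le> b / real b ^ X" unfolding abs using hb(3) H0 by simp
  show ?thesis using Q1 Q2 1 2 by blast
qed

theorem extremal_word_exponent:
  assumes b: "b \<ge> 2"
  shows "irrationality_exponent (word_value b extremal_word) = ereal (1 + growth)"
proof -
  \<comment> \<open>The two families of repetitions are interleaved so that the error exponent of
    each one is the position that bounds the next denominator. The shift by 3 is the range of
    \<open>growth_ratio\<close>.\<close>
  define Y where "Y m = (if even m then denom_sum (m div 2 + 3) else denom (m div 2 + 3) + denom (m div 2 + 4))" for m
  have Ye: "Y (2 * k) = denom_sum (k + 3)" and Yo: "Y (Suc (2 * k)) = denom (k + 3) + denom (k + 4)" for k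
    by (simp_all add: Y_def)
  have Yee: "Y (Suc (Suc (2 * k))) = denom_sum (k + 4)" for k using Ye[of "Suc k"] by (simp add: numeral_eq_Suc)
  have cases: "(\<exists>k. m = 2 * k) \<or> (\<exists>k. m = Suc (2 * k))" for m :: nat by presburger
  interpret approximation_chain b "word_value b extremal_word" growth 3 Y
  proof
    show "b \<ge> 2" using b .
    show "1 < growth" using sqrt10_bounds by simp
  next
    fix m
    consider k where "m = 2 * k" | k where "m = Suc (2 * k)" using cases by blast
    then show "m \<le> Y m"
    proof cases
      case 1
      then show ?thesis using denom_sum_ge[of "k + 2"] Ye[of k] by (simp add: numeral_eq_Suc)
    next
      case 2
      then show ?thesis using denom_ge[of "k + 3"] denom_ge[of "k + 4"] Yo[of k] by simp
    qed
  next
    fix m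
    consider k where "m = 2 * k" | k where "m = Suc (2 * k)" using cases by blast
    then show "\<exists>(Q::int) (R::int). 1 \<le> Q \<and> Q \<le> int b ^ Y m
        \<and> 1 / real b ^ Y (Suc m) \<le> \<bar>Q * word_value b extremal_word - R\<bar>
        \<and> \<bar>Q * word_value b extremal_word - R\<bar> \<le> b / real b ^ Y (Suc m)"
    proof cases
      case 1
      have f: "first_deviation (denom_sum (k + 2)) (denom_sum (k + 3)) (numer (k + 3)) (denom (k + 3) + denom (k + 4))"
        using first_deviation_interior[of "k + 2"] by (simp add: numeral_eq_Suc)
      show ?thesis unfolding 1 Ye Yo
      proof (rule extremal_approximant[OF b _ _ f])
        show "denom_sum (k + 2) < denom_sum (k + 3)"
          using denom_sum_Suc[of "k + 2"] denom_pos[of "k + 3"] by (simp add: numeral_eq_Suc)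
        show "1 \<le> denom (k + 3) + denom (k + 4)" using denom_pos[of "k + 3"] by simp
      qed
    next
      case 2
      have f: "first_deviation 0 (denom (k + 3) + denom (k + 4)) (numer (k + 3) + numer (k + 4)) (denom_sum (k + 4))"
        using first_deviation_prefix[of "k + 3"] by (simp add: numeral_eq_Suc)
      show ?thesis unfolding 2 Yo Yee
      proof (rule extremal_approximant[OF b _ _ f])
        show "0 < denom (k + 3) + denom (k + 4)" using denom_pos[of "k + 3"] by simp
        show "1 \<le> denom_sum (k + 4)" using denom_sum_ge[of "k + 3"] by (simp add: numeral_eq_Suc)
      qed
    qed
  next
    fix m
    consider k where "m = 2 * k" | k where "m = Suc (2 * k)" using cases by blast
    then show "Y (Suc m) \<le> growth * Y m + 3"
    proof cases
      case 1
      show ?thesis unfolding 1 Ye Yo using growth_ratio(1)[of "k + 3"] by (simp add: numeral_eq_Suc)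
    next
      case 2
      show ?thesis unfolding 2 Yo Yee using growth_ratio(2)[of "k + 3"] by (simp add: numeral_eq_Suc)
    qed
  next
    fix n
    \<comment> \<open>This odd index belongs to the tight residue class: its denominators have
      indices 3 * Suc n + 2 and 3 * Suc n + 3.\<close>
    define m where "m = Suc (2 * (3 * n + 2))"
    have Ym: "Y m = denom (3 * Suc n + 2) + denom (3 * Suc n + 3)"
      unfolding m_def Yo by (simp add: numeral_eq_Suc)
    have YSm: "Y (Suc m) = denom_sum (3 * Suc n + 3)"
      unfolding m_def Yee by (simp add: numeral_eq_Suc)
    have "growth * Y m - 3 \<le> Y (Suc m)"
      unfolding Ym YSm using denom_sum_ratio_sharp[of "Suc n", THEN abs_le_D2] by linarith
    moreover have "n \<le> m" by (simp add: m_def)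
    ultimately show "\<exists>m\<ge>n. growth * Y m - 3 \<le> Y (Suc m)" by blast
  qed
  show ?thesis by (rule exponent_eq)
qed

theorem theorem4p3:
  fixes b :: nat
  assumes "b \<ge> 2"
  shows "(\<forall>s. word_over b s \<and> (sturmian s \<or> quasi_sturmian s) \<longrightarrow>
            irrationality_exponent (word_value b s) \<ge> ereal (5/3 + 4 * sqrt 10 / 15))
       \<and> (let \<theta> = (sqrt 10 - 2) / 3; \<rho> = (sqrt 10 - 1) / 3;
              s = (\<lambda>n::nat. nat (\<lfloor>(real n + 1) * \<theta> + \<rho>\<rfloor> - \<lfloor>real n * \<theta> + \<rho>\<rfloor>))
          in irrationality_exponent (word_value b s) = ereal (5/3 + 4 * sqrt 10 / 15))"
proof (intro conjI allI impI)
  fix s assume s: "word_over b s \<and> (sturmian s \<or> quasi_sturmian s)"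
  interpret digit_word b s using assms s by unfold_locales auto
  have "quasi_sturmian s" if "sturmian s"
    unfolding quasi_sturmian_def using that
    by (intro exI[of _ 1] exI[of _ "1::nat"]) (simp add: sturmian_def)
  then show "irrationality_exponent (word_value b s) \<ge> ereal (5/3 + 4 * sqrt 10 / 15)"
    using s quasi_sturmian_exponent by blast
next
  have "(\<lambda>n::nat. nat (\<lfloor>(real n + 1) * slope + intercept\<rfloor> - \<lfloor>real n * slope + intercept\<rfloor>)) = extremal_word"
    by (simp add: fun_eq_iff extremal_word_def mech_def add.commute)
  moreover have "1 + growth = 5/3 + 4 * sqrt 10 / 15" by simp
  ultimately show "let \<theta> = (sqrt 10 - 2) / 3; \<rho> = (sqrt 10 - 1) / 3;
              s = (\<lambda>n::nat. nat (\<lfloor>(real n + 1) * \<theta> + \<rho>\<rfloor> - \<lfloor>real n * \<theta> + \<rho>\<rfloor>))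
          in irrationality_exponent (word_value b s) = ereal (5/3 + 4 * sqrt 10 / 15)"
    using extremal_word_exponent[OF assms] unfolding Let_def slope_def intercept_def by simp
qed

end
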